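(* Suppose (in the notation of the context) that $X$ is sub-Gaussian and that assumptions (A2), (A4) and (A5) hold. Let $k_0>0$ and $m_1=16s(1+k_0)^2$. For any $\epsilon$ with $$0<\epsilon<\frac{\lambda_{\min,z}^{1/2}}{8\lambda_{\max,z}^{1/2}+\lambda_{\min,z}^{1/2}}$$ there are positive constants $c_1,C_0,C_1,C_K,\tilde C_K$ with $\tilde C_K<C_K$ (not depending on $n,p,s$) such that, with $\delta_0=C_K-\tilde C_K>0$: if $$n>\epsilon^{-1}\max\Bigl\{C_1,\ \bigl(c_1m_1\tilde C_K^{-1}\log(c_1m_1p_1)\bigr)^3,\ \bigl(4^{-1}\tilde C_K^{-1}c_1m_1\log(4c_1m_1p_1)\bigr)^3\Bigr\},$$ then the restricted eigenvalue condition $M(k_0,s)>0$ holds for $\mathbb{Z}$ with probability at least $$\tilde p_{0n}=1-2C_0\exp\bigl(-n^{1/3}\epsilon^{1/3}\delta_0\bigr),$$ which tends to $1$ as $n\to\infty$.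
   Context: $X,X_1,\ldots,X_n$ are i.i.d. random vectors in $\mathbb{R}^p$, $p_1=p(p+1)/2$, and $Z=(X^T,X^{*T})^T\in\mathbb{R}^{p_1}$, where $X^*$ lists all interactions $X_{(k_1)}X_{(k_2)}$, $1\le k_1<k_2\le p$, of the coordinates of $X$; $Z_i$ is built from $X_i$ in the same way. Main effects and interactions are centered: $E(X)=0$ and $E(X_{(k_1)}X_{(k_2)})=0$ for $k_1<k_2$ (otherwise each is replaced by itself minus its expectation). $\mathbb{Z}=(Z_1,\ldots,Z_n)^T\in\mathbb{R}^{n\times p_1}$. $s$ is a positive integer (the sparsity level). Norms: for a random vector $X$, $K_x=\|X\|_{\psi_2}=\sup_{\|u\|_2=1}\sup_{q\ge1}q^{-1/2}(E|u^TX|^q)^{1/q}$; $X$ is sub-Gaussian if $K_x<\infty$ ($K_x$ a constant not depending on $n,p$). For a scalar $Y$, $\|Y\|_{\psi_1}=\sup_{q\ge1}q^{-1}(E|Y|^q)^{1/q}$; $Y$ is subexponential if this is finite. (A2): there are fixed constants $a_1,a_2$ such that the smallest and largest eigenvalues of $\Sigma_z=\mathrm{cov}(Z)$ satisfy $0<a_1<\lambda_{\min,z}\le\lambda_{\max,z}<a_2<\infty$. For $u$ in the unit sphere $S^{p_1-1}=\{a\in\mathbb{R}^{p_1}:\|a\|_2=1\}$ write $u=(u^{(1)T},u^{(2)T})^T$ with $u^{(1)}\in\mathbb{R}^p$ and $u^{(2)}=(w_{12},\ldots,w_{1p},w_{23},\ldots,w_{(p-1)p})^T$, and let $W=(w_{ij})$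 be the symmetric $p\times p$ matrix with $w_{ji}=w_{ij}$ for $i<j$ and $w_{ii}=0$. If $u^{(1)}\ne0$ and $u^{(2)}\neq0$ put $\rho_u=\mathrm{corr}(X^Tu^{(1)},X^TWX)$; otherwise $\rho_u=0$. If $u^{(2)}\neq0$ put $X_W^*=[\mathrm{var}(X^TWX)]^{-1/2}X^TWX$; if $u^{(2)}=0$ put $X_W^*=0$. (A4): $\sup_{u\in S^{p_1-1}}|\rho_u|\le\bar\rho<1$ for some constant $\bar\rho$. (A5): $X_W^*$ is subexponential with $\psi_1$ norm $K_u$, and $\sup_{u\in S^{p_1-1}}K_u$ is bounded by a finite constant. Restricted eigenvalue (RE) condition with parameters $k_0,s$: $$M(k_0,s)=\min_{J\subseteq\{1,\ldots,p_1\},\,|J|\le s}\ \min_{\alpha\ne0:\ \|\alpha_{J^c}\|_1\le k_0\|\alpha_J\|_1}\frac{\|\mathbb{Z}\alpha\|_2}{\sqrt n\,\|\alpha_J\|_2}>0,$$ where $\alpha_A\in\mathbb{R}^{p_1}$ has $j$th entry $\alpha_j$ if $j\in A$ and $0$ otherwise. *)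

theory Defs
  imports "HOL-Probability.Probability" "Jordan_Normal_Form.Spectral_Radius"
begin

unbundle no vec_syntax
hide_const (open) Finite_Cartesian_Product.vec
hide_type (open) Finite_Cartesian_Product.vec

text \<open>
  The constants of the theorem must not depend on the dimension \<open>p\<close>, so dimensions are numbers
  and not types.  Deterministic vectors and matrices are those of \<open>Jordan_Normal_Form\<close>; a random
  vector in \<open>\<real>\<^sup>p\<close> is a measurable map into the product space \<open>rvec_space p\<close>.  Coordinates are
  counted from 0.
\<close>

definition rvec_space :: "nat \<Rightarrow> (nat \<Rightarrow> real) measure" where
  "rvec_space p = (\<Pi>\<^sub>M k\<in>{..<p}. borel)"

definition l2_norm :: "real vec \<Rightarrow> real" where
  "l2_norm v = L2_set (\<lambda>i. v $ i) {..<dim_vec v}"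

definition l1_norm :: "real vec \<Rightarrow> real" where
  "l1_norm v = (\<Sum>i<dim_vec v. \<bar>v $ i\<bar>)"

definition unit_sphere :: "nat \<Rightarrow> real vec set" where
  "unit_sphere d = {u \<in> carrier_vec d. l2_norm u = 1}"

definition restrict_vec :: "real vec \<Rightarrow> nat set \<Rightarrow> real vec" where
  "restrict_vec v A = vec (dim_vec v) (\<lambda>j. if j \<in> A then v $ j else 0)"

definition covariance :: "'w measure \<Rightarrow> ('w \<Rightarrow> real) \<Rightarrow> ('w \<Rightarrow> real) \<Rightarrow> real" where
  "covariance M Y V =
     (\<integral>\<omega>. (Y \<omega> - (\<integral>\<omega>'. Y \<omega>' \<partial>M)) * (V \<omega> - (\<integral>\<omega>'. V \<omega>' \<partial>M)) \<partial>M)"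

definition correlation :: "'w measure \<Rightarrow> ('w \<Rightarrow> real) \<Rightarrow> ('w \<Rightarrow> real) \<Rightarrow> real" where
  "correlation M Y V = covariance M Y V / sqrt (covariance M Y Y * covariance M V V)"

definition Lq_norm :: "'w measure \<Rightarrow> real \<Rightarrow> ('w \<Rightarrow> real) \<Rightarrow> ereal" where
  "Lq_norm M q Y =
     (if integrable M (\<lambda>\<omega>. \<bar>Y \<omega>\<bar> powr q)
      then ereal ((\<integral>\<omega>. \<bar>Y \<omega>\<bar> powr q \<partial>M) powr (1 / q)) else \<infinity>)"

definition psi1_norm :: "'w measure \<Rightarrow> ('w \<Rightarrow> real) \<Rightarrow> ereal" where
  "psi1_norm M Y = (SUP q\<in>{1..}. ereal (1 / q) * Lq_norm M q Y)"

definition psi2_norm_vec :: "'w measure \<Rightarrow> nat \<Rightarrow> ('w \<Rightarrow> nat \<Rightarrow> real) \<Rightarrow> ereal" where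
  "psi2_norm_vec M p X =
     (SUP u\<in>unit_sphere p. SUP q\<in>{1..}.
        ereal (q powr (- 1 / 2)) * Lq_norm M q (\<lambda>\<omega>. u \<bullet> vec p (X \<omega>)))"

definition inter_pairs :: "nat \<Rightarrow> (nat \<times> nat) list" where
  "inter_pairs p = [(j, k). j \<leftarrow> [0..<p], k \<leftarrow> [Suc j..<p]]"

definition dim_z :: "nat \<Rightarrow> nat" where
  "dim_z p = p * (p + 1) div 2"

definition zraw :: "nat \<Rightarrow> (nat \<Rightarrow> real) \<Rightarrow> real vec" where
  "zraw p x = vec p x @\<^sub>v vec_of_list (map (\<lambda>(j, k). x j * x k) (inter_pairs p))"

text \<open>
  Centering is built into the design vector: every main effect and every interaction is replaced by
  itself minus its expectation.  If these expectations vanish, \<open>zvec M p X \<omega> = zraw p (X \<omega>)\<close>.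
\<close>

definition zvec :: "'w measure \<Rightarrow> nat \<Rightarrow> ('w \<Rightarrow> nat \<Rightarrow> real) \<Rightarrow> 'w \<Rightarrow> real vec" where
  "zvec M p X \<omega> = zraw p (X \<omega>) - vec (dim_z p) (\<lambda>l. \<integral>\<omega>'. zraw p (X \<omega>') $ l \<partial>M)"

definition Sigma_z :: "'w measure \<Rightarrow> nat \<Rightarrow> ('w \<Rightarrow> nat \<Rightarrow> real) \<Rightarrow> real mat" where
  "Sigma_z M p X = mat (dim_z p) (dim_z p)
     (\<lambda>(i, j). covariance M (\<lambda>\<omega>. zvec M p X \<omega> $ i) (\<lambda>\<omega>. zvec M p X \<omega> $ j))"

definition lambda_min_z :: "'w measure \<Rightarrow> nat \<Rightarrow> ('w \<Rightarrow> nat \<Rightarrow> real) \<Rightarrow> real" where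
  "lambda_min_z M p X = Min (spectrum (Sigma_z M p X))"

definition lambda_max_z :: "'w measure \<Rightarrow> nat \<Rightarrow> ('w \<Rightarrow> nat \<Rightarrow> real) \<Rightarrow> real" where
  "lambda_max_z M p X = Max (spectrum (Sigma_z M p X))"

definition main_part :: "nat \<Rightarrow> real vec \<Rightarrow> real vec" where
  "main_part p u = vec_first u p"

definition inter_part :: "nat \<Rightarrow> real vec \<Rightarrow> real vec" where
  "inter_part p u = vec_last u (dim_z p - p)"

text \<open>
  The coefficient vector \<open>inter_part p u\<close> is indexed by \<open>inter_pairs p\<close>, i.e. lexicographically by
  the pairs \<open>(j, k)\<close> with \<open>j < k\<close>; \<open>map_of\<close> looks up \<open>w\<^sub>j\<^sub>k\<close>.
\<close>

definition W_mat :: "nat \<Rightarrow> real vec \<Rightarrow> real mat" where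
  "W_mat p u = mat p p (\<lambda>(i, j).
     if i = j then 0
     else the (map_of (zip (inter_pairs p) (list_of_vec (inter_part p u))) (min i j, max i j)))"

definition quad_form :: "nat \<Rightarrow> real vec \<Rightarrow> (nat \<Rightarrow> real) \<Rightarrow> real" where
  "quad_form p u x = vec p x \<bullet> (W_mat p u *\<^sub>v vec p x)"

definition rho :: "'w measure \<Rightarrow> nat \<Rightarrow> ('w \<Rightarrow> nat \<Rightarrow> real) \<Rightarrow> real vec \<Rightarrow> real" where
  "rho M p X u =
     (if main_part p u \<noteq> 0\<^sub>v p \<and> inter_part p u \<noteq> 0\<^sub>v (dim_z p - p)
      then correlation M (\<lambda>\<omega>. vec p (X \<omega>) \<bullet> main_part p u) (\<lambda>\<omega>. quad_form p u (X \<omega>))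
      else 0)"

text \<open>
  Since \<open>X\<^sup>TWX = 2 \<Sum>\<^sub>i\<^sub><\<^sub>j w\<^sub>i\<^sub>j X\<^sub>i X\<^sub>j\<close>, centering the interactions amounts to subtracting the expectation of
  the quadratic form; this expectation is 0 if the interactions are already centered.
\<close>

definition XW_star :: "'w measure \<Rightarrow> nat \<Rightarrow> ('w \<Rightarrow> nat \<Rightarrow> real) \<Rightarrow> real vec \<Rightarrow> 'w \<Rightarrow> real" where
  "XW_star M p X u \<omega> =
     (if inter_part p u \<noteq> 0\<^sub>v (dim_z p - p)
      then (quad_form p u (X \<omega>) - (\<integral>\<omega>'. quad_form p u (X \<omega>') \<partial>M)) /
        sqrt (covariance M (\<lambda>\<omega>. quad_form p u (X \<omega>)) (\<lambda>\<omega>. quad_form p u (X \<omega>)))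
      else 0)"

text \<open>\<open>X 0\<close> is the generic copy, \<open>X 1, \<dots>, X n\<close> is the sample.\<close>

definition iid_model :: "'w measure \<Rightarrow> nat \<Rightarrow> nat \<Rightarrow> (nat \<Rightarrow> 'w \<Rightarrow> nat \<Rightarrow> real) \<Rightarrow> bool" where
  "iid_model M p n X \<longleftrightarrow>
     prob_space.indep_vars M (\<lambda>_. rvec_space p) X {0..n} \<and>
     (\<forall>i\<in>{0..n}. distr M (rvec_space p) (X i) = distr M (rvec_space p) (X 0))"

definition sub_Gaussian ::
  "real \<Rightarrow> 'w measure \<Rightarrow> nat \<Rightarrow> ('w \<Rightarrow> nat \<Rightarrow> real) \<Rightarrow> bool" where
  "sub_Gaussian K M p X \<longleftrightarrow> psi2_norm_vec M p X \<le> ereal K"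

definition assumption_A2 ::
  "real \<Rightarrow> real \<Rightarrow> 'w measure \<Rightarrow> nat \<Rightarrow> ('w \<Rightarrow> nat \<Rightarrow> real) \<Rightarrow> bool" where
  "assumption_A2 a\<^sub>1 a\<^sub>2 M p X \<longleftrightarrow>
     0 < a\<^sub>1 \<and> a\<^sub>1 < lambda_min_z M p X \<and> lambda_min_z M p X \<le> lambda_max_z M p X \<and>
     lambda_max_z M p X < a\<^sub>2"

definition assumption_A4 ::
  "real \<Rightarrow> 'w measure \<Rightarrow> nat \<Rightarrow> ('w \<Rightarrow> nat \<Rightarrow> real) \<Rightarrow> bool" where
  "assumption_A4 \<rho>bar M p X \<longleftrightarrow>
     (SUP u\<in>unit_sphere (dim_z p). ereal \<bar>rho M p X u\<bar>) \<le> ereal \<rho>bar \<and> \<rho>bar < 1"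

definition assumption_A5 ::
  "real \<Rightarrow> 'w measure \<Rightarrow> nat \<Rightarrow> ('w \<Rightarrow> nat \<Rightarrow> real) \<Rightarrow> bool" where
  "assumption_A5 K M p X \<longleftrightarrow>
     (SUP u\<in>unit_sphere (dim_z p). psi1_norm M (XW_star M p X u)) \<le> ereal K"

definition design_matrix ::
  "'w measure \<Rightarrow> nat \<Rightarrow> nat \<Rightarrow> (nat \<Rightarrow> 'w \<Rightarrow> nat \<Rightarrow> real) \<Rightarrow> 'w \<Rightarrow> real mat" where
  "design_matrix M p n X \<omega> = mat_of_rows (dim_z p) (map (\<lambda>i. zvec M p (X i) \<omega>) [1..<Suc n])"

text \<open>
  For \<open>J = {}\<close> no \<open>\<alpha>\<close> is admissible and the inner infimum is \<open>\<infinity>\<close>.  For other \<open>J\<close> the cone condition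
  forces \<open>\<alpha>\<^sub>J \<noteq> 0\<close>, and by homogeneity and compactness the infimum is attained, i.e. is a minimum.
\<close>

definition re_const :: "real mat \<Rightarrow> real \<Rightarrow> nat \<Rightarrow> ereal" where
  "re_const A k\<^sub>0 s =
     (INF J\<in>{J. J \<subseteq> {..<dim_col A} \<and> card J \<le> s}.
      INF \<alpha>\<in>{\<alpha> \<in> carrier_vec (dim_col A). \<alpha> \<noteq> 0\<^sub>v (dim_col A) \<and>
               l1_norm (restrict_vec \<alpha> (- J)) \<le> k\<^sub>0 * l1_norm (restrict_vec \<alpha> J)}.
        ereal (l2_norm (A *\<^sub>v \<alpha>) / (sqrt (real (dim_row A)) * l2_norm (restrict_vec \<alpha> J))))"

lemma length_inter_pairs: "2 * (p + length (inter_pairs p)) = p * (p + 1)"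
proof -
  have len: "length (inter_pairs p) = (\<Sum>j<p. p - Suc j)"
    by (simp add: inter_pairs_def length_concat o_def interv_sum_list_conv_sum_set_nat
        atLeast0LessThan)
  have "(\<Sum>j<p. p - Suc j) = (\<Sum>j<p. j)"
    by (rule sum.nat_diff_reindex)
  moreover have "2 * (\<Sum>j<p. j) + p = p * p" for p :: nat
    by (induction p) (auto simp: algebra_simps)
  ultimately show ?thesis
    using len by (simp add: algebra_simps)
qed

lemma dim_zraw: "dim_vec (zraw p x) = dim_z p"
  using length_inter_pairs[of p] by (simp add: zraw_def dim_z_def)

lemma length_inter_part: "length (list_of_vec (inter_part p u)) = length (inter_pairs p)"
  using length_inter_pairs[of p] by (simp add: inter_part_def dim_z_def)

end

theory Submission
  imports Defs "HOL-Real_Asymp.Real_Asymp"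
begin

unbundle no inner_syntax

text \<open>
  On the cone, \<open>|\<alpha>|\<^sub>1\<^sup>2 \<le> (1 + k\<^sub>0)\<^sup>2 s |\<alpha>\<^sub>J|\<^sub>2\<^sup>2\<close>.  Hence, if every entry of the sample covariance is within
  \<open>\<tau> = a\<^sub>1 / (2 s (1 + k\<^sub>0)\<^sup>2) = 8 a\<^sub>1 / m\<^sub>1\<close> of the corresponding entry of \<open>\<Sigma>\<^sub>z\<close>, then the quadratic form of the
  sample covariance is at least \<open>(a\<^sub>1 / 2) |\<alpha>\<^sub>J|\<^sub>2\<^sup>2\<close> there.  The centered entries are averages of products of
  at most four sub-Gaussian variables, so \<open>exp (2 b sqrt |\<cdot>|)\<close> has bounded expectation for some \<open>b\<close> depending
  only on the sub-Gaussian constant.  With \<open>N = n\<^sup>1\<^sup>/\<^sup>3\<close>, truncation at \<open>N\<^sup>2\<close> and Chernoff's method with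
  parameter \<open>b / N\<close> bound the probability of a deviation \<open>\<tau>\<close> by
  \<open>n D exp (- 2 b N) + exp (C N - b N\<^sup>2 \<tau>)\<close>.  As \<open>N\<close> is a large multiple of \<open>m\<^sub>1 log (c\<^sub>1 m\<^sub>1 p\<^sub>1)\<close>, a union bound
  over the \<open>p\<^sub>1\<^sup>2\<close> entries leaves a bound of order \<open>exp (- b N)\<close>.
\<close>

subsection \<open>Concentration of sums with stretched-exponential tails\<close>

text \<open>One term of a series of nonnegative terms. Every comparison of a power with an
  exponential below comes from it; at \<open>x = n\<close> it gives
  \<open>n ^ n / fact n \<le> exp n\<close>.\<close>

lemma power_div_fact_le_exp:
  fixes x :: real
  assumes "0 \<le> x"
  shows "x ^ n / fact n \<le> exp x"
proof -
  obtain t where "exp x = (\<Sum>m<Suc n. x ^ m / fact m) + exp t / fact (Suc n) * x ^ Suc n"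
    using Maclaurin_exp_le[of x "Suc n"] by blast
  moreover have "0 \<le> (\<Sum>m<n. x ^ m / fact m)" "0 \<le> exp t / fact (Suc n) * x ^ Suc n"
    using assms by (auto intro!: sum_nonneg)
  ultimately show ?thesis by simp
qed

text \<open>Taylor's formula with Lagrange remainder. The linear term is kept exactly, so that it
  vanishes in expectation for a variable of mean zero.\<close>

lemma exp_le_quadratic:
  fixes x :: real
  shows "exp x \<le> 1 + x + x\<^sup>2 / 2 * exp \<bar>x\<bar>"
proof -
  obtain t where t: "\<bar>t\<bar> \<le> \<bar>x\<bar>" and "exp x = (\<Sum>m<2. x ^ m / fact m) + exp t / fact 2 * x ^ 2"
    using Maclaurin_exp_le[of x 2] by blast
  then have "exp x = 1 + x + x\<^sup>2 / 2 * exp t"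
    by (simp add: numeral_2_eq_2)
  also have "\<dots> \<le> 1 + x + x\<^sup>2 / 2 * exp \<bar>x\<bar>"
    using t by (intro add_left_mono mult_left_mono) auto
  finally show ?thesis .
qed

text \<open>The term of degree four of the exponential series at
  \<open>b * sqrt \<bar>y\<bar>\<close>; 24 is \<open>fact 4\<close>.\<close>

lemma square_le_exp_sqrt:
  fixes y b :: real
  assumes "0 < b"
  shows "y\<^sup>2 \<le> 24 / b ^ 4 * exp (b * sqrt \<bar>y\<bar>)"
proof -
  have "sqrt \<bar>y\<bar> ^ 4 = (sqrt \<bar>y\<bar> ^ 2) ^ 2"
    by (simp only: flip: power_mult) simp
  also have "\<dots> = y\<^sup>2"
    by simp
  finally have "(b * sqrt \<bar>y\<bar>) ^ 4 = b ^ 4 * y\<^sup>2"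
    by (simp add: power_mult_distrib)
  with power_div_fact_le_exp[of "b * sqrt \<bar>y\<bar>" 4] assms
  have "b ^ 4 * y\<^sup>2 / 24 \<le> exp (b * sqrt \<bar>y\<bar>)"
    by (simp add: fact_numeral)
  then show ?thesis
    using assms by (simp add: field_simps)
qed

text \<open>
  Truncating at \<open>N\<^sup>2\<close> with exponent \<open>b / N\<close> is the scaling at which the moment generating function of
  a variable with finite \<open>exp (2 b sqrt |y|)\<close>-moment stays under control: on the event
  \<open>|y| \<le> N\<^sup>2\<close> one has \<open>|y| / N \<le> sqrt |y|\<close>, and the bias of the truncation is of order \<open>y\<^sup>2 / N\<^sup>2\<close>.
\<close>

lemma exp_truncation_le:
  fixes y b N :: real
  assumes b: "0 < b" and N: "0 < N"
  shows "exp (b / N * (if \<bar>y\<bar> \<le> N\<^sup>2 then y else 0))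
    \<le> 1 + b / N * y + (24 / (b ^ 3 * N ^ 3) + 12 / (b\<^sup>2 * N\<^sup>2)) * exp (2 * b * sqrt \<bar>y\<bar>)"
proof -
  define z where "z = (if \<bar>y\<bar> \<le> N\<^sup>2 then y else 0)"
  define G where "G = exp (2 * b * sqrt \<bar>y\<bar>)"
  have G: "exp (b * sqrt \<bar>y\<bar>) * exp (b * sqrt \<bar>y\<bar>) = G"
    by (simp add: G_def flip: exp_add)
  have G1: "exp (b * sqrt \<bar>y\<bar>) \<le> G"
    using b by (simp add: G_def)
  have sq: "y\<^sup>2 \<le> 24 / b ^ 4 * exp (b * sqrt \<bar>y\<bar>)"
    by (rule square_le_exp_sqrt[OF b])
  have abs_z: "b / N * \<bar>z\<bar> \<le> b * sqrt \<bar>y\<bar>"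
  proof (cases "\<bar>y\<bar> \<le> N\<^sup>2")
    case True
    then have "sqrt \<bar>y\<bar> \<le> N"
      using N by (simp add: real_le_lsqrt)
    then have "sqrt \<bar>y\<bar> * sqrt \<bar>y\<bar> \<le> N * sqrt \<bar>y\<bar>"
      by (intro mult_right_mono) auto
    then have "\<bar>y\<bar> \<le> N * sqrt \<bar>y\<bar>" by simp
    with True b N show ?thesis by (simp add: z_def field_simps)
  qed (use b in \<open>simp add: z_def\<close>)
  have z_sq: "z\<^sup>2 \<le> y\<^sup>2"
    by (simp add: z_def)
  \<comment> \<open>The linear term must contain \<open>y\<close>, whose mean will be zero, and not
    its truncation. Beyond the threshold \<open>z = 0\<close>, and
    \<open>- y \<le> \<bar>y\<bar>\<close> is at most \<open>y\<^sup>2 / N\<^sup>2\<close>.\<close>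
  have "z \<le> y + y\<^sup>2 / N\<^sup>2"
  proof (cases "\<bar>y\<bar> \<le> N\<^sup>2")
    case False
    then have "\<bar>y\<bar> * N\<^sup>2 \<le> \<bar>y\<bar> * \<bar>y\<bar>" by (intro mult_left_mono) auto
    then have "\<bar>y\<bar> \<le> y\<^sup>2 / N\<^sup>2"
      using N by (simp add: field_simps power2_eq_square)
    then show ?thesis using False by (simp add: z_def)
  qed (use N in \<open>simp add: z_def\<close>)
  also have "\<dots> \<le> y + (24 / b ^ 4 * G) / N\<^sup>2"
    by (intro add_left_mono divide_right_mono order.trans[OF sq] mult_left_mono G1) auto
  finally have "b / N * z \<le> b / N * (y + (24 / b ^ 4 * G) / N\<^sup>2)"
    using b N by (intro mult_left_mono) auto
  also have "\<dots> = b / N * y + 24 / (b ^ 3 * N ^ 3) * G"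
    using b N by (simp add: field_simps power_numeral_reduce)
  finally have lin: "b / N * z \<le> b / N * y + 24 / (b ^ 3 * N ^ 3) * G" .
  \<comment> \<open>One factor \<open>exp (b * sqrt \<bar>y\<bar>)\<close> comes from the Taylor
    remainder, a second one from bounding \<open>y\<^sup>2\<close>. Their product is
    \<open>G\<close>; hence the coefficient \<open>2 * b\<close> in the moment.\<close>
  have "(b / N * z)\<^sup>2 / 2 * exp \<bar>b / N * z\<bar> \<le> (b / N)\<^sup>2 * y\<^sup>2 / 2 * exp (b * sqrt \<bar>y\<bar>)"
    using abs_z b N z_sq unfolding power_mult_distrib
    by (intro mult_mono divide_right_mono mult_left_mono) (auto simp: abs_mult)
  also have "\<dots> \<le> (b / N)\<^sup>2 * (24 / b ^ 4 * exp (b * sqrt \<bar>y\<bar>)) / 2 * exp (b * sqrt \<bar>y\<bar>)"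
    by (intro mult_right_mono divide_right_mono mult_left_mono sq) auto
  also have "\<dots> = (b / N)\<^sup>2 * 12 / b ^ 4 * G"
    by (simp add: G[symmetric])
  also have "\<dots> = 12 / (b\<^sup>2 * N\<^sup>2) * G"
    using b N by (simp add: field_simps power_numeral_reduce)
  finally have "(b / N * z)\<^sup>2 / 2 * exp \<bar>b / N * z\<bar> \<le> 12 / (b\<^sup>2 * N\<^sup>2) * G" .
  with lin exp_le_quadratic[of "b / N * z"] show ?thesis
    unfolding z_def[symmetric] G_def[symmetric] by (simp add: distrib_right)
qed

text \<open>The zero mean removes the linear term of the pointwise bound and leaves
  \<open>1 + c * D \<le> exp (c * D)\<close>, a form that multiplies well over independent
  variables.\<close>

lemma (in prob_space) mgf_truncation_le:
  assumes b: "0 < b" and N: "0 < N"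
    and Y: "integrable M Y" "expectation Y = 0"
    and G: "integrable M (\<lambda>\<omega>. exp (2 * b * sqrt \<bar>Y \<omega>\<bar>))"
      "expectation (\<lambda>\<omega>. exp (2 * b * sqrt \<bar>Y \<omega>\<bar>)) \<le> D"
  shows "integrable M (\<lambda>\<omega>. exp (b / N * (if \<bar>Y \<omega>\<bar> \<le> N\<^sup>2 then Y \<omega> else 0)))" (is ?int)
    and "expectation (\<lambda>\<omega>. exp (b / N * (if \<bar>Y \<omega>\<bar> \<le> N\<^sup>2 then Y \<omega> else 0)))
      \<le> exp ((24 / (b ^ 3 * N ^ 3) + 12 / (b\<^sup>2 * N\<^sup>2)) * D)"
proof -
  note [measurable] = borel_measurable_integrable[OF Y(1)]
  define c where "c = 24 / (b ^ 3 * N ^ 3) + 12 / (b\<^sup>2 * N\<^sup>2)"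
  have c: "c \<ge> 0" using b N by (simp add: c_def)
  define g where "g \<omega> = 1 + b / N * Y \<omega> + c * exp (2 * b * sqrt \<bar>Y \<omega>\<bar>)" for \<omega>
  have g: "integrable M g"
    unfolding g_def using Y(1) G(1) by simp
  have le: "exp (b / N * (if \<bar>Y \<omega>\<bar> \<le> N\<^sup>2 then Y \<omega> else 0)) \<le> g \<omega>" for \<omega>
    unfolding g_def c_def by (rule exp_truncation_le[OF b N])
  show int: ?int
    by (rule Bochner_Integration.integrable_bound[OF g])
      (use order.trans[OF le abs_ge_self] in \<open>auto simp del: if_split\<close>)
  have "expectation (\<lambda>\<omega>. exp (b / N * (if \<bar>Y \<omega>\<bar> \<le> N\<^sup>2 then Y \<omega> else 0))) \<le> expectation g"
    by (intro integral_mono int g le)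
  also have "\<dots> = 1 + c * expectation (\<lambda>\<omega>. exp (2 * b * sqrt \<bar>Y \<omega>\<bar>))"
    unfolding g_def using Y G(1) by (simp add: prob_space)
  also have "\<dots> \<le> 1 + c * D"
    using G(2) c by (intro add_left_mono mult_left_mono)
  also have "\<dots> \<le> exp (c * D)"
    by (rule exp_ge_add_one_self)
  finally show "expectation (\<lambda>\<omega>. exp (b / N * (if \<bar>Y \<omega>\<bar> \<le> N\<^sup>2 then Y \<omega> else 0)))
      \<le> exp ((24 / (b ^ 3 * N ^ 3) + 12 / (b\<^sup>2 * N\<^sup>2)) * D)"
    by (simp add: c_def)
qed

text \<open>Either some variable exceeds \<open>N\<^sup>2\<close> in modulus, which Markov's
  inequality for \<open>exp (2 * b * sqrt \<bar>Y i \<omega>\<bar>)\<close> makes unlikely, or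
  truncation changes nothing and Chernoff's bound with parameter \<open>b / N\<close> applies. The
  two cases give the two summands.\<close>

lemma (in prob_space) sum_tail_bound:
  assumes b: "0 < b" and N: "0 < N" "N ^ 3 = real n"
    and indep: "indep_vars (\<lambda>_. borel) Y {1..n}"
    and Y: "\<And>i. i \<in> {1..n} \<Longrightarrow> integrable M (Y i)" "\<And>i. i \<in> {1..n} \<Longrightarrow> expectation (Y i) = 0"
    and G: "\<And>i. i \<in> {1..n} \<Longrightarrow> integrable M (\<lambda>\<omega>. exp (2 * b * sqrt \<bar>Y i \<omega>\<bar>))"
      "\<And>i. i \<in> {1..n} \<Longrightarrow> expectation (\<lambda>\<omega>. exp (2 * b * sqrt \<bar>Y i \<omega>\<bar>)) \<le> D"
  shows "prob {\<omega> \<in> space M. (\<Sum>i\<in>{1..n}. Y i \<omega>) \<ge> real n * t}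
    \<le> real n * D * exp (- (2 * b * N)) + exp (12 * D / b\<^sup>2 * N + 24 * D / b ^ 3 - b * N\<^sup>2 * t)"
proof -
  define T where "T y = (if \<bar>y\<bar> \<le> N\<^sup>2 then y else 0)" for y :: real
  have [measurable]: "T \<in> borel_measurable borel" unfolding T_def by measurable
  have Ym [measurable]: "i \<in> {1..n} \<Longrightarrow> Y i \<in> borel_measurable M" for i
    using Y(1) by blast
  define E where "E i \<omega> = exp (b / N * T (Y i \<omega>))" for i \<omega>
  have indepE: "indep_vars (\<lambda>_. borel) E {1..n}"
    unfolding E_def by (rule indep_vars_compose2[OF indep]) simp
  have E: "integrable M (E i)"
    "expectation (E i) \<le> exp ((24 / (b ^ 3 * N ^ 3) + 12 / (b\<^sup>2 * N\<^sup>2)) * D)" if "i \<in> {1..n}" for i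
    using mgf_truncation_le[OF b N(1) Y[OF that] G[OF that]] by (auto simp: E_def[abs_def] T_def simp del: times_divide_eq_left)
  have E_pos: "0 \<le> E i \<omega>" for i \<omega>
    by (simp add: E_def)
  define A where "A i = {\<omega> \<in> space M. \<bar>Y i \<omega>\<bar> > N\<^sup>2}" for i
  define B where "B = {\<omega> \<in> space M. (\<Prod>i\<in>{1..n}. E i \<omega>) \<ge> exp (b * N\<^sup>2 * t)}"
  have sets[measurable]: "i \<in> {1..n} \<Longrightarrow> A i \<in> events" "B \<in> events" for i
    unfolding A_def B_def E_def by measurable
  have "expectation (\<lambda>\<omega>. \<Prod>i\<in>{1..n}. E i \<omega>) = (\<Prod>i\<in>{1..n}. expectation (E i))"
    by (intro indep_vars_lebesgue_integral indepE E) auto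
  also have "\<dots> \<le> (\<Prod>i\<in>{1..n}. exp ((24 / (b ^ 3 * N ^ 3) + 12 / (b\<^sup>2 * N\<^sup>2)) * D))"
    by (intro prod_mono conjI E integral_nonneg) (auto simp: E_def)
  also have "\<dots> = exp (12 * D / b\<^sup>2 * N + 24 * D / b ^ 3)"
  proof -
    \<comment> \<open>As \<open>n = N ^ 3\<close>, the cubic error sums to a constant and the
      quadratic one to a multiple of \<open>N\<close>.\<close>
    have "real n * ((24 / (b ^ 3 * N ^ 3) + 12 / (b\<^sup>2 * N\<^sup>2)) * D) = 12 * D / b\<^sup>2 * N + 24 * D / b ^ 3"
      using b N(1) by (simp add: N(2)[symmetric] field_simps power_numeral_reduce)
    then show ?thesis by (simp flip: exp_of_nat_mult)
  qed
  finally have mgf: "expectation (\<lambda>\<omega>. \<Prod>i\<in>{1..n}. E i \<omega>) \<le> exp (12 * D / b\<^sup>2 * N + 24 * D / b ^ 3)" .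
  have "prob B \<le> expectation (\<lambda>\<omega>. \<Prod>i\<in>{1..n}. E i \<omega>) / exp (b * N\<^sup>2 * t)"
    unfolding B_def
    by (rule integral_Markov_inequality_measure[where A="{}"])
      (auto simp: E_pos prod_nonneg simp del: One_nat_def intro!: indep_vars_integrable indepE E(1))
  also have "\<dots> \<le> exp (12 * D / b\<^sup>2 * N + 24 * D / b ^ 3) / exp (b * N\<^sup>2 * t)"
    by (intro divide_right_mono mgf) simp
  finally have PB: "prob B \<le> exp (12 * D / b\<^sup>2 * N + 24 * D / b ^ 3 - b * N\<^sup>2 * t)"
    by (simp add: exp_diff)
  have "{\<omega> \<in> space M. (\<Sum>i\<in>{1..n}. Y i \<omega>) \<ge> real n * t} \<subseteq> (\<Union>i\<in>{1..n}. A i) \<union> B"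
  proof
    fix \<omega> assume \<omega>: "\<omega> \<in> {\<omega> \<in> space M. (\<Sum>i\<in>{1..n}. Y i \<omega>) \<ge> real n * t}"
    show "\<omega> \<in> (\<Union>i\<in>{1..n}. A i) \<union> B"
    proof (cases "\<exists>i\<in>{1..n}. \<bar>Y i \<omega>\<bar> > N\<^sup>2")
      case False
      then have "T (Y i \<omega>) = Y i \<omega>" if "i \<in> {1..n}" for i
        using that by (force simp: T_def)
      then have "(\<Prod>i\<in>{1..n}. E i \<omega>) = exp (b / N * (\<Sum>i\<in>{1..n}. Y i \<omega>))"
        by (simp add: E_def exp_sum sum_distrib_left)
      moreover have "b * N\<^sup>2 * t = b / N * (real n * t)"
        using N by (simp add: N(2)[symmetric] power_numeral_reduce)
      moreover have "b / N * (real n * t) \<le> b / N * (\<Sum>i\<in>{1..n}. Y i \<omega>)"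
        using \<omega> b N by (intro mult_left_mono) auto
      ultimately show ?thesis using \<omega> by (simp add: B_def)
    qed (use \<omega> in \<open>auto simp: A_def\<close>)
  qed
  then have "prob {\<omega> \<in> space M. (\<Sum>i\<in>{1..n}. Y i \<omega>) \<ge> real n * t} \<le> prob ((\<Union>i\<in>{1..n}. A i) \<union> B)"
    by (intro finite_measure_mono) auto
  also have "\<dots> \<le> (\<Sum>i\<in>{1..n}. prob (A i)) + prob B"
    by (intro order.trans[OF measure_Un_le] add_mono finite_measure_subadditive_finite) auto
  also have "(\<Sum>i\<in>{1..n}. prob (A i)) \<le> (\<Sum>i\<in>{1..n}. D * exp (- (2 * b * N)))"
  proof (rule sum_mono)
    fix i assume i: "i \<in> {1..n}"
    have "prob (A i) \<le> prob {\<omega> \<in> space M. exp (2 * b * sqrt \<bar>Y i \<omega>\<bar>) \<ge> exp (2 * b * N)}"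
      using i b N by (intro finite_measure_mono) (auto simp: A_def intro!: real_le_rsqrt)
    also have "\<dots> \<le> expectation (\<lambda>\<omega>. exp (2 * b * sqrt \<bar>Y i \<omega>\<bar>)) / exp (2 * b * N)"
      by (rule integral_Markov_inequality_measure[where A="{}"]) (auto intro!: G i)
    also have "\<dots> \<le> D / exp (2 * b * N)"
      by (intro divide_right_mono G i) auto
    finally show "prob (A i) \<le> D * exp (- (2 * b * N))"
      by (simp add: exp_minus divide_inverse)
  qed
  finally show ?thesis using PB by simp
qed

subsection \<open>Deterministic bounds and measurability for the restricted eigenvalue\<close>

text \<open>A parabola through the origin that stays nonnegative has slope zero there. This serves
  as the first-order condition at a minimizer of the quadratic form.\<close>

lemma linear_coeff_zeroI:
  fixes a b :: real
  assumes "\<And>t. 0 \<le> 2 * t * a + t\<^sup>2 * b"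
  shows "a = 0"
proof (rule ccontr)
  assume "a \<noteq> 0"
  \<comment> \<open>The test point \<open>- a / B\<close> minimizes the parabola with
    \<open>b\<close> replaced by \<open>B\<close>, which is positive whatever the sign of
    \<open>b\<close>.\<close>
  define B where "B = \<bar>b\<bar> + 1"
  have B: "B > 0" "b < B" by (auto simp: B_def)
  have "0 \<le> 2 * (- a / B) * a + (- a / B)\<^sup>2 * b" by (rule assms)
  also have "\<dots> = (a\<^sup>2 / B) * (b / B - 2)"
    using B by (simp add: field_simps power2_eq_square)
  also have "\<dots> < 0"
    using B \<open>a \<noteq> 0\<close> by (intro mult_pos_neg) (auto simp: field_simps)
  finally show False by simp
qed

text \<open>
  The vectors of \<open>Jordan_Normal_Form\<close> carry no topology, so compactness and separability
  arguments take place in \<open>nat \<Rightarrow> real\<close> with the product topology.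
\<close>

lemma compact_sphere_fun:
  "compact {x :: nat \<Rightarrow> real. (\<forall>i\<ge>d. x i = 0) \<and> (\<Sum>i<d. (x i)\<^sup>2) = 1}"
proof -
  \<comment> \<open>Coordinates from \<open>d\<close> on are confined to \<open>{0}\<close>, so the
    sphere is a closed subset of a product of compact sets, which is compact by Tychonoff.\<close>
  define B :: "nat \<Rightarrow> real set" where "B i = (if i < d then {-1..1} else {0})" for i
  have "compactin (product_topology (\<lambda>i::nat. euclidean :: real topology) UNIV) (PiE UNIV B)"
    unfolding compactin_PiE by (auto simp: B_def)
  then have B: "compact (PiE UNIV B)"
    by (simp add: euclidean_product_topology)
  have C: "closed {x :: nat \<Rightarrow> real. (\<Sum>i<d. (x i)\<^sup>2) = 1}"
    by (intro closed_Collect_eq continuous_intros) simp_all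
  have "{x :: nat \<Rightarrow> real. (\<forall>i\<ge>d. x i = 0) \<and> (\<Sum>i<d. (x i)\<^sup>2) = 1}
    = PiE UNIV B \<inter> {x. (\<Sum>i<d. (x i)\<^sup>2) = 1}" (is "?L = ?R")
  proof (intro equalityI subsetI)
    fix x assume x: "x \<in> ?L"
    have "\<bar>x i\<bar> \<le> 1" if "i < d" for i
    proof -
      have "(x i)\<^sup>2 \<le> (\<Sum>i<d. (x i)\<^sup>2)"
        using that by (intro member_le_sum) auto
      with x show ?thesis by (simp add: abs_square_le_1)
    qed
    with x show "x \<in> ?R"
      by (auto simp: B_def abs_le_iff PiE_def Pi_def)
  next
    fix x assume x: "x \<in> ?R"
    have "x i = 0" if "d \<le> i" for i
      using PiE_mem[of x UNIV B i] x that by (simp add: B_def)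
    with x show "x \<in> ?L" by simp
  qed
  with compact_Int_closed[OF B C] show ?thesis by simp
qed

lemma scalar_prod_self_eq:
  "v \<in> carrier_vec d \<Longrightarrow> v \<bullet> v = (\<Sum>i<d. (v $ i)\<^sup>2 :: real)"
  by (auto simp: scalar_prod_def power2_eq_square atLeast0LessThan)

lemma quadratic_form_eq:
  assumes "A \<in> carrier_mat d d" "v \<in> carrier_vec d"
  shows "v \<bullet> (A *\<^sub>v v) = (\<Sum>i<d. \<Sum>j<d. v $ i * v $ j * (A $$ (i, j) :: real))"
  using assms
  by (auto simp: scalar_prod_def atLeast0LessThan sum_distrib_left mult_ac intro!: sum.cong)

text \<open>By compactness the form attains its minimum \<open>m\<close> on the unit sphere at some
  \<open>w\<close>. The first-order condition makes \<open>w\<close> an eigenvector for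
  \<open>m\<close>, so \<open>m\<close> lies in the spectrum, and homogeneity extends the bound from
  the sphere to all vectors.\<close>

lemma Min_spectrum_le_quadratic_form:
  fixes A :: "real mat"
  assumes A: "A \<in> carrier_mat d d" and sym: "transpose_mat A = A" and v: "v \<in> carrier_vec d"
  shows "Min (spectrum A) * (v \<bullet> v) \<le> v \<bullet> (A *\<^sub>v v)"
proof (cases "v \<bullet> v = 0")
  case True
  then have "\<forall>i<d. v $ i = 0"
    unfolding scalar_prod_self_eq[OF v] by (simp add: sum_nonneg_eq_0_iff)
  then have "v \<bullet> (A *\<^sub>v v) = 0"
    using quadratic_form_eq[OF A v] by simp
  with True show ?thesis by simp
next
  case False
  define S where "S = {x :: nat \<Rightarrow> real. (\<forall>i\<ge>d. x i = 0) \<and> (\<Sum>i<d. (x i)\<^sup>2) = 1}"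
  define Q where "Q x = vec d x \<bullet> (A *\<^sub>v vec d x)" for x
  define fn where "fn u i = (if i < d then u $ i / sqrt (u \<bullet> u) else 0)" for u :: "real vec" and i
  have pos: "u \<bullet> u \<ge> 0" if "u \<in> carrier_vec d" for u :: "real vec"
    using that by (simp add: scalar_prod_self_eq sum_nonneg)
  have fn: "fn u \<in> S" "Q (fn u) = (u \<bullet> (A *\<^sub>v u)) / (u \<bullet> u)"
    if u: "u \<in> carrier_vec d" "u \<bullet> u \<noteq> 0" for u :: "real vec"
  proof -
    have u0: "u \<bullet> u > 0" using pos[OF u(1)] u(2) by simp
    have "(\<Sum>i<d. (fn u i)\<^sup>2) = (\<Sum>i<d. (u $ i)\<^sup>2) / (u \<bullet> u)"
      using u0 by (auto simp: fn_def power_divide sum_divide_distrib intro!: sum.cong)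
    then show "fn u \<in> S"
      using u by (simp add: S_def fn_def scalar_prod_self_eq)
    have "vec d (fn u) = (1 / sqrt (u \<bullet> u)) \<cdot>\<^sub>v u"
      using u by (auto simp: fn_def)
    then show "Q (fn u) = (u \<bullet> (A *\<^sub>v u)) / (u \<bullet> u)"
      using A u u0 by (simp add: Q_def mult_mat_vec)
  qed
  have "continuous_on UNIV Q"
    unfolding Q_def quadratic_form_eq[OF A vec_carrier]
    by (auto intro!: continuous_intros)
  then have "continuous_on S Q" by (rule continuous_on_subset) simp
  moreover have "compact S" unfolding S_def by (rule compact_sphere_fun)
  moreover have "S \<noteq> {}" using fn(1)[OF v False] by auto
  ultimately obtain x where x: "x \<in> S" "\<And>y. y \<in> S \<Longrightarrow> Q x \<le> Q y"
    using continuous_attains_inf[of S Q] by blast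
  define w where "w = vec d x"
  define m where "m = Q x"
  have w: "w \<in> carrier_vec d" by (simp add: w_def)
  have ww: "w \<bullet> w = 1" using x by (simp add: w_def S_def scalar_prod_self_eq)
  have min: "m * (u \<bullet> u) \<le> u \<bullet> (A *\<^sub>v u)" if u: "u \<in> carrier_vec d" for u
  proof (cases "u \<bullet> u = 0")
    case True
    then have "\<forall>i<d. u $ i = 0"
      unfolding scalar_prod_self_eq[OF u] by (simp add: sum_nonneg_eq_0_iff)
    then have "u \<bullet> (A *\<^sub>v u) = 0"
      using quadratic_form_eq[OF A u] by simp
    with True show ?thesis by simp
  next
    case False
    with x(2)[OF fn(1)[OF u False]] pos[OF u] show ?thesis
      by (simp add: fn(2)[OF u] m_def field_simps)
  qed
  \<comment> \<open>The residual of the eigenvalue equation. Moving from \<open>w\<close> in the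
    direction \<open>r\<close> changes the form minus \<open>m\<close> times the squared norm by
    \<open>2 * t * (r \<bullet> r)\<close> to first order, so minimality forces
    \<open>r \<bullet> r = 0\<close>.\<close>
  define r where "r = A *\<^sub>v w - m \<cdot>\<^sub>v w"
  have Aw: "A *\<^sub>v w \<in> carrier_vec d" and r: "r \<in> carrier_vec d" and Ar: "A *\<^sub>v r \<in> carrier_vec d"
    using A w by (auto simp: r_def)
  have swap: "w \<bullet> (A *\<^sub>v r) = r \<bullet> (A *\<^sub>v w)"
    using transpose_vec_mult_scalar[OF A r w] comm_scalar_prod[OF Aw r] by (simp add: sym)
  have rw: "r \<bullet> w = w \<bullet> r" by (rule comm_scalar_prod[OF r w])
  have rr: "r \<bullet> r = r \<bullet> (A *\<^sub>v w) - m * (w \<bullet> r)"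
    using Aw w r by (subst (2) r_def) (simp add: scalar_prod_minus_distrib[of _ d] rw)
  have "r \<bullet> r = 0"
  proof (rule linear_coeff_zeroI)
    fix t :: real
    have "m * ((w + t \<cdot>\<^sub>v r) \<bullet> (w + t \<cdot>\<^sub>v r)) \<le> (w + t \<cdot>\<^sub>v r) \<bullet> (A *\<^sub>v (w + t \<cdot>\<^sub>v r))"
      using w r by (intro min) auto
    also have "(w + t \<cdot>\<^sub>v r) \<bullet> (w + t \<cdot>\<^sub>v r) = 1 + 2 * t * (w \<bullet> r) + t\<^sup>2 * (r \<bullet> r)"
      using w r by (simp add: add_scalar_prod_distrib[of _ d] scalar_prod_add_distrib[of _ d] ww rw
          power2_eq_square distrib_left)
    also have "A *\<^sub>v (w + t \<cdot>\<^sub>v r) = A *\<^sub>v w + t \<cdot>\<^sub>v (A *\<^sub>v r)"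
      using A w r by (simp add: mult_add_distrib_mat_vec[OF A] mult_mat_vec[OF A])
    also have "(w + t \<cdot>\<^sub>v r) \<bullet> \<dots> = m + 2 * t * (r \<bullet> (A *\<^sub>v w)) + t\<^sup>2 * (r \<bullet> (A *\<^sub>v r))"
      using w r Aw Ar by (simp add: add_scalar_prod_distrib[of _ d] scalar_prod_add_distrib[of _ d] swap
          power2_eq_square distrib_left m_def Q_def w_def[symmetric])
    finally show "0 \<le> 2 * t * (r \<bullet> r) + t\<^sup>2 * (r \<bullet> (A *\<^sub>v r) - m * (r \<bullet> r))"
      by (simp add: rr algebra_simps)
  qed
  then have "\<forall>i<d. r $ i = 0"
    unfolding scalar_prod_self_eq[OF r] by (simp add: sum_nonneg_eq_0_iff)
  then have "A *\<^sub>v w = m \<cdot>\<^sub>v w"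
    using A w by (auto simp: r_def intro!: eq_vecI)
  moreover have "w \<noteq> 0\<^sub>v d" using ww w by auto
  ultimately have "m \<in> spectrum A"
    using A w by (auto simp: spectrum_def eigenvalue_def eigenvector_def)
  then have "Min (spectrum A) \<le> m"
    using card_finite_spectrum[OF A] by (intro Min_le) auto
  with min[OF v] pos[OF v] show ?thesis
    by (meson mult_right_mono order.trans)
qed

section \<open>Entrywise closeness implies a positive restricted eigenvalue\<close>

text \<open>An entrywise error \<tau> perturbs the quadratic form by at most \<tau> times the
  squared l1 norm, which the cone condition and Cauchy-Schwarz on \<open>J\<close> control. Since
  \<open>re_const\<close> is an infimum, positivity of each quotient would not suffice; the proof
  gives the uniform bound \<open>sqrt (a / 2)\<close>.\<close>

lemma re_const_pos:
  fixes A :: "real mat"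
  assumes A: "A \<in> carrier_mat n d" and n: "0 < n" and S: "S \<in> carrier_mat d d"
    and a: "0 < a" and k: "0 \<le> k\<^sub>0"
    and lower: "\<And>v. v \<in> carrier_vec d \<Longrightarrow> a * (v \<bullet> v) \<le> v \<bullet> (S *\<^sub>v v)"
    and close: "\<And>i j. i < d \<Longrightarrow> j < d \<Longrightarrow>
      \<bar>(\<Sum>r<n. A $$ (r, i) * A $$ (r, j)) / real n - S $$ (i, j)\<bar> \<le> \<tau>"
    and \<tau>: "0 \<le> \<tau>" "2 * \<tau> * real s * (1 + k\<^sub>0)\<^sup>2 \<le> a"
  shows "0 < re_const A k\<^sub>0 s"
proof -
  have dims: "dim_col A = d" "dim_row A = n" using A by auto
  have bound: "sqrt (a / 2) \<le> l2_norm (A *\<^sub>v \<alpha>) / (sqrt (real n) * l2_norm (restrict_vec \<alpha> J))"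
    if J: "J \<subseteq> {..<d}" "card J \<le> s" and \<alpha>: "\<alpha> \<in> carrier_vec d" "\<alpha> \<noteq> 0\<^sub>v d"
      and cone: "l1_norm (restrict_vec \<alpha> (- J)) \<le> k\<^sub>0 * l1_norm (restrict_vec \<alpha> J)" for J \<alpha>
  proof -
    have J_Int: "{..<d} \<inter> J = J" using J by auto
    define L where "L = (\<Sum>i\<in>J. \<bar>\<alpha> $ i\<bar>)"
    define E where "E = (\<Sum>i\<in>J. (\<alpha> $ i)\<^sup>2)"
    have L: "l1_norm (restrict_vec \<alpha> J) = L"
      using \<alpha>(1) by (simp add: l1_norm_def restrict_vec_def L_def if_distrib sum.inter_restrict[symmetric]
          J_Int cong: if_cong)
    have "(\<Sum>i<d. \<bar>\<alpha> $ i\<bar>) = (\<Sum>i<d. \<bar>if i \<in> J then \<alpha> $ i else 0\<bar> + \<bar>if i \<in> - J then \<alpha> $ i else 0\<bar>)"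
      by (intro sum.cong) auto
    also have "\<dots> = l1_norm (restrict_vec \<alpha> J) + l1_norm (restrict_vec \<alpha> (- J))"
      using \<alpha>(1) by (simp add: l1_norm_def restrict_vec_def sum.distrib)
    also have "\<dots> \<le> (1 + k\<^sub>0) * L" using cone by (simp add: L algebra_simps)
    finally have l1: "(\<Sum>i<d. \<bar>\<alpha> $ i\<bar>) \<le> (1 + k\<^sub>0) * L" .
    have E: "l2_norm (restrict_vec \<alpha> J) = sqrt E"
      using \<alpha>(1) by (simp add: l2_norm_def L2_set_def restrict_vec_def E_def if_distrib[of "\<lambda>x. x\<^sup>2"]
          sum.inter_restrict[symmetric] J_Int cong: if_cong)
    have "L\<^sup>2 \<le> real (card J) * E"
      unfolding L_def E_def
      using sum_squared_le_sum_of_squares[of "\<lambda>i. \<bar>\<alpha> $ i\<bar>" J] by (simp add: mult.commute)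
    also have "\<dots> \<le> real s * E"
      using J(2) by (intro mult_right_mono) (auto simp: E_def sum_nonneg)
    finally have CS: "L\<^sup>2 \<le> real s * E" .
    \<comment> \<open>On the cone, a vanishing \<open>J\<close>-part forces the whole vector to
      vanish. This makes the denominator positive and also disposes of empty
      \<open>J\<close>.\<close>
    have "E \<noteq> 0"
    proof
      assume "E = 0"
      then have "L = 0" using CS by simp
      then have "(\<Sum>i<d. \<bar>\<alpha> $ i\<bar>) = 0"
        using l1 by (intro order.antisym) (auto simp: sum_nonneg)
      then have "\<forall>i<d. \<alpha> $ i = 0" by (simp add: sum_nonneg_eq_0_iff)
      with \<alpha> show False by auto
    qed
    then have E_pos: "0 < E" by (simp add: E_def sum_nonneg order.strict_iff_order)
    define H where "H i j = (\<Sum>r<n. A $$ (r, i) * A $$ (r, j)) / real n" for i j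
    have "(l2_norm (A *\<^sub>v \<alpha>))\<^sup>2 = (\<Sum>r<n. (\<Sum>i<d. A $$ (r, i) * \<alpha> $ i)\<^sup>2)"
      using A \<alpha>(1) by (simp add: l2_norm_def L2_set_def sum_nonneg scalar_prod_def atLeast0LessThan)
    also have "\<dots> = (\<Sum>r<n. \<Sum>i<d. \<Sum>j<d. \<alpha> $ i * \<alpha> $ j * (A $$ (r, i) * A $$ (r, j)))"
      by (simp add: power2_eq_square sum_product mult_ac)
    also have "\<dots> = (\<Sum>i<d. \<Sum>j<d. \<Sum>r<n. \<alpha> $ i * \<alpha> $ j * (A $$ (r, i) * A $$ (r, j)))"
      by (subst sum.swap, rule sum.cong[OF refl], rule sum.swap)
    also have "\<dots> = (\<Sum>i<d. \<Sum>j<d. real n * (\<alpha> $ i * \<alpha> $ j * H i j))"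
      using n by (intro sum.cong refl) (simp add: H_def flip: sum_distrib_left)
    also have "\<dots> = real n * (\<Sum>i<d. \<Sum>j<d. \<alpha> $ i * \<alpha> $ j * H i j)"
      by (simp only: sum_distrib_left)
    finally have norm_eq: "(l2_norm (A *\<^sub>v \<alpha>))\<^sup>2 = real n * (\<Sum>i<d. \<Sum>j<d. \<alpha> $ i * \<alpha> $ j * H i j)" .
    have "\<alpha> \<bullet> (S *\<^sub>v \<alpha>) - (\<Sum>i<d. \<Sum>j<d. \<alpha> $ i * \<alpha> $ j * H i j)
      = (\<Sum>i<d. \<Sum>j<d. \<alpha> $ i * \<alpha> $ j * (S $$ (i, j) - H i j))"
      unfolding quadratic_form_eq[OF S \<alpha>(1)] by (simp add: right_diff_distrib sum_subtractf)
    also have "\<dots> \<le> (\<Sum>i<d. \<Sum>j<d. \<bar>\<alpha> $ i\<bar> * \<bar>\<alpha> $ j\<bar> * \<tau>)"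
    proof (intro sum_mono)
      fix i j assume "i \<in> {..<d}" "j \<in> {..<d}"
      then have "\<bar>S $$ (i, j) - H i j\<bar> \<le> \<tau>"
        using close[of i j] by (simp add: H_def abs_minus_commute)
      then have "\<bar>\<alpha> $ i * \<alpha> $ j * (S $$ (i, j) - H i j)\<bar> \<le> \<bar>\<alpha> $ i\<bar> * \<bar>\<alpha> $ j\<bar> * \<tau>"
        unfolding abs_mult by (intro mult_left_mono) auto
      then show "\<alpha> $ i * \<alpha> $ j * (S $$ (i, j) - H i j) \<le> \<bar>\<alpha> $ i\<bar> * \<bar>\<alpha> $ j\<bar> * \<tau>" by simp
    qed
    also have "\<dots> = \<tau> * (\<Sum>i<d. \<bar>\<alpha> $ i\<bar>)\<^sup>2"
      by (simp add: power2_eq_square sum_product sum_distrib_left mult_ac)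
    also have "\<dots> \<le> \<tau> * ((1 + k\<^sub>0) * L)\<^sup>2"
      using l1 \<tau>(1) by (intro mult_left_mono power_mono) (auto simp: sum_nonneg)
    also have "\<dots> = \<tau> * (1 + k\<^sub>0)\<^sup>2 * L\<^sup>2" by (simp add: power_mult_distrib)
    also have "\<dots> \<le> \<tau> * (1 + k\<^sub>0)\<^sup>2 * (real s * E)"
      using CS \<tau>(1) by (intro mult_left_mono) auto
    also have "\<dots> = (\<tau> * real s * (1 + k\<^sub>0)\<^sup>2) * E" by simp
    also have "\<dots> \<le> a / 2 * E"
      using \<tau>(2) E_pos by (intro mult_right_mono) auto
    finally have "\<alpha> \<bullet> (S *\<^sub>v \<alpha>) - a / 2 * E \<le> (\<Sum>i<d. \<Sum>j<d. \<alpha> $ i * \<alpha> $ j * H i j)" by simp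
    moreover have "E \<le> \<alpha> \<bullet> \<alpha>"
      unfolding scalar_prod_self_eq[OF \<alpha>(1)] E_def using J by (intro sum_mono2) auto
    then have "a * E \<le> \<alpha> \<bullet> (S *\<^sub>v \<alpha>)"
      using lower[OF \<alpha>(1)] a by (meson less_imp_le mult_left_mono order.trans)
    ultimately have "a / 2 * E \<le> (\<Sum>i<d. \<Sum>j<d. \<alpha> $ i * \<alpha> $ j * H i j)" by simp
    then have "real n * (a / 2 * E) \<le> (l2_norm (A *\<^sub>v \<alpha>))\<^sup>2"
      unfolding norm_eq by (intro mult_left_mono) auto
    then have "sqrt (a / 2) * (sqrt (real n) * sqrt E) \<le> l2_norm (A *\<^sub>v \<alpha>)"
      unfolding real_sqrt_mult[symmetric] by (intro real_le_lsqrt) (auto simp: l2_norm_def mult_ac)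
    then show ?thesis
      using n E_pos by (simp add: E pos_le_divide_eq del: real_sqrt_divide)
  qed
  have "0 < sqrt (a / 2)" using a by simp
  moreover have "ereal (sqrt (a / 2)) \<le> re_const A k\<^sub>0 s"
    unfolding re_const_def dims by (intro INF_greatest) (use bound in auto)
  ultimately show ?thesis
    by (metis ereal_less(2) order_less_le_trans)
qed

section \<open>Measurability of the restricted eigenvalue\<close>

text \<open>Each value on \<open>S\<close> is a limit of values along a sequence in
  \<open>C\<close>. The purpose is to replace an uncountable infimum of measurable functions by a
  countable one.\<close>

lemma INF_dense_subset:
  fixes f :: "'a::metric_space \<Rightarrow> ereal"
  assumes "C \<subseteq> S" "S \<subseteq> closure C" "continuous_on S f"
  shows "(INF x\<in>S. f x) = (INF x\<in>C. f x)"
proof (rule antisym)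
  show "(INF x\<in>S. f x) \<le> (INF x\<in>C. f x)"
    by (rule INF_superset_mono[OF assms(1)]) simp
  show "(INF x\<in>C. f x) \<le> (INF x\<in>S. f x)"
  proof (rule INF_greatest)
    fix x assume x: "x \<in> S"
    then obtain g where g: "\<And>n. g n \<in> C" "g \<longlonglongrightarrow> x"
      using assms(2) closure_sequential by blast
    have "(\<lambda>n. f (g n)) \<longlonglongrightarrow> f x"
      using assms(3) x g assms(1) unfolding continuous_on_sequentially comp_def by blast
    then show "(INF x\<in>C. f x) \<le> f x"
      by (rule LIMSEQ_le_const) (auto intro!: INF_lower g)
  qed
qed

text \<open>For fixed \<open>J\<close> the quotient is continuous on the cone, so its infimum may be
  taken over a countable dense subset; there are finitely many \<open>J\<close>.\<close>

lemma borel_measurable_re_const: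
  assumes A: "\<And>\<omega>. A \<omega> \<in> carrier_mat n d" and n: "0 < n" and k: "0 \<le> k\<^sub>0"
    and meas: "\<And>i j. i < n \<Longrightarrow> j < d \<Longrightarrow> (\<lambda>\<omega>. A \<omega> $$ (i, j)) \<in> borel_measurable M"
  shows "(\<lambda>\<omega>. re_const (A \<omega>) k\<^sub>0 s) \<in> borel_measurable M"
proof -
  have dims: "dim_col (A \<omega>) = d" "dim_row (A \<omega>) = n" for \<omega> using A[of \<omega>] by auto
  \<comment> \<open>The cone is lifted to functions, where a topology is available. Coordinates from
    \<open>d\<close> on stay free, because \<open>vec d\<close> discards them.\<close>
  define D where "D J = {x :: nat \<Rightarrow> real. (\<exists>i<d. x i \<noteq> 0) \<and>
    l1_norm (restrict_vec (vec d x) (- J)) \<le> k\<^sub>0 * l1_norm (restrict_vec (vec d x) J)}" for J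
  define f where "f J \<omega> x = ereal (l2_norm (A \<omega> *\<^sub>v vec d x) /
    (sqrt (real n) * l2_norm (restrict_vec (vec d x) J)))" for J \<omega> x
  obtain C where C: "\<And>J. countable (C J)" "\<And>J. C J \<subseteq> D J" "\<And>J. D J \<subseteq> closure (C J)"
  proof -
    have "\<exists>C. countable C \<and> C \<subseteq> D J \<and> D J \<subseteq> closure C" for J
      by (metis separable)
    then show ?thesis using that by metis
  qed
  have img: "{\<alpha> \<in> carrier_vec d. \<alpha> \<noteq> 0\<^sub>v d \<and>
      l1_norm (restrict_vec \<alpha> (- J)) \<le> k\<^sub>0 * l1_norm (restrict_vec \<alpha> J)} = vec d ` D J" for J
  proof (intro equalityI subsetI)
    fix \<alpha> :: "real vec"
    assume \<alpha>: "\<alpha> \<in> {\<alpha> \<in> carrier_vec d. \<alpha> \<noteq> 0\<^sub>v d \<and>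
      l1_norm (restrict_vec \<alpha> (- J)) \<le> k\<^sub>0 * l1_norm (restrict_vec \<alpha> J)}"
    have "\<alpha> = vec d (vec_index \<alpha>)" using \<alpha> by auto
    moreover have "\<exists>i<d. \<alpha> $ i \<noteq> 0" using \<alpha> by (auto simp: vec_eq_iff)
    ultimately show "\<alpha> \<in> vec d ` D J" using \<alpha> by (auto simp: D_def intro!: image_eqI[where x="vec_index \<alpha>"])
  qed (auto simp: D_def vec_eq_iff)
  \<comment> \<open>Continuity of the quotient needs a nonzero denominator: on the cone a vanishing
    \<open>J\<close>-part would force the complementary part to vanish too.\<close>
  have nz: "l2_norm (restrict_vec (vec d x) J) \<noteq> 0" if x: "x \<in> D J" for x J
  proof
    assume "l2_norm (restrict_vec (vec d x) J) = 0"
    then have "\<forall>i<d. (if i \<in> J then vec d x $ i else 0) = 0"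
      by (auto simp: l2_norm_def L2_set_eq_0_iff restrict_vec_def)
    then have *: "\<forall>i<d. i \<in> J \<longrightarrow> x i = 0"
      by (metis index_vec)
    then have "l1_norm (restrict_vec (vec d x) J) = 0"
      by (auto simp: l1_norm_def restrict_vec_def intro!: sum.neutral)
    then have "l1_norm (restrict_vec (vec d x) (- J)) = 0"
      using x k by (intro antisym) (auto simp: D_def l1_norm_def sum_nonneg)
    then have "\<forall>i<d. (if i \<notin> J then vec d x $ i else 0) = 0"
      by (auto simp: l1_norm_def restrict_vec_def sum_nonneg_eq_0_iff)
    then have "\<forall>i<d. i \<notin> J \<longrightarrow> x i = 0"
      by (metis index_vec)
    with * x show False by (auto simp: D_def)
  qed
  have cont: "continuous_on (D J) (f J \<omega>)" for J \<omega>
  proof -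
    have "continuous_on (D J) (\<lambda>x. l2_norm (A \<omega> *\<^sub>v vec d x))"
      using A[of \<omega>] unfolding l2_norm_def L2_set_def
      by (auto simp: scalar_prod_def dims intro!: continuous_intros continuous_on_subset[OF continuous_on_product_coordinates])
    moreover have "l2_norm (restrict_vec (vec d x) J) = sqrt (\<Sum>i\<in>{..<d} \<inter> J. (x i)\<^sup>2)" for x
      by (auto simp: l2_norm_def L2_set_def restrict_vec_def sum.inter_restrict intro!: sum.cong)
    then have "continuous_on (D J) (\<lambda>x. l2_norm (restrict_vec (vec d x) J))"
      by (auto intro!: continuous_intros continuous_on_subset[OF continuous_on_product_coordinates])
    ultimately show ?thesis
      unfolding f_def using nz n
      by (intro continuous_on_ereal continuous_on_divide continuous_on_mult continuous_on_const) auto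
  qed
  have "(INF x\<in>D J. f J \<omega> x) = (INF x\<in>C J. f J \<omega> x)" for J \<omega>
    by (rule INF_dense_subset[OF C(2,3) cont])
  then have "re_const (A \<omega>) k\<^sub>0 s = (INF J\<in>{J. J \<subseteq> {..<d} \<and> card J \<le> s}. INF x\<in>C J. f J \<omega> x)" for \<omega>
    unfolding re_const_def dims img image_image f_def by simp
  moreover have "(\<lambda>\<omega>. f J \<omega> x) \<in> borel_measurable M" for J x
  proof -
    have "l2_norm (A \<omega> *\<^sub>v vec d x) = sqrt (\<Sum>i<n. (\<Sum>j<d. A \<omega> $$ (i, j) * x j)\<^sup>2)" for \<omega>
      using A[of \<omega>] by (simp add: l2_norm_def L2_set_def scalar_prod_def atLeast0LessThan)
    then show ?thesis
      unfolding f_def using meas by simp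
  qed
  moreover have "countable {J. J \<subseteq> {..<d} \<and> card J \<le> s}"
    by (rule countable_finite) (auto intro: finite_subset[of _ "Pow {..<d}"])
  ultimately show ?thesis
    using C(1) by simp
qed

subsection \<open>Moments of the design entries\<close>

text \<open>The exponential is integrated term by term. The moment of order \<open>2 * m\<close> is
  at most \<open>(2 * K\<^sup>2 * m) ^ m\<close>, and \<open>m ^ m / fact m \<le> exp m\<close>;
  \<open>c\<close> is chosen to make the resulting geometric ratio \<open>1 / 2\<close>, so the
  series sums to 2.\<close>

lemma (in prob_space) exp_square_moment_le:
  fixes X :: "'a \<Rightarrow> real"
  assumes K: "0 < K" and [measurable]: "X \<in> borel_measurable M"
    and int: "\<And>q. 1 \<le> q \<Longrightarrow> integrable M (\<lambda>\<omega>. \<bar>X \<omega>\<bar> powr q)"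
    and mom: "\<And>q. 1 \<le> q \<Longrightarrow> expectation (\<lambda>\<omega>. \<bar>X \<omega>\<bar> powr q) \<le> (K * sqrt q) powr q"
  defines "c \<equiv> 1 / (4 * exp 1 * K\<^sup>2)"
  shows "integrable M (\<lambda>\<omega>. exp (c * (X \<omega>)\<^sup>2))" and "expectation (\<lambda>\<omega>. exp (c * (X \<omega>)\<^sup>2)) \<le> 2"
proof -
  have c: "0 < c" using K by (simp add: c_def)
  define g where "g m \<omega> = (c * (X \<omega>)\<^sup>2) ^ m /\<^sub>R fact m" for m \<omega>
  have g_nonneg: "0 \<le> g m \<omega>" for m \<omega> using c by (simp add: g_def)
  have g_le: "(\<integral>\<^sup>+\<omega>. ennreal (g m \<omega>) \<partial>M) \<le> ennreal ((1 / 2) ^ m)" for m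
  \<comment> \<open>The term \<open>m = 0\<close> is separate because the moment bounds start at
    order 1.\<close>
  proof (cases "m = 0")
    case False
    have pw: "\<bar>X \<omega>\<bar> powr real (2 * m) = ((X \<omega>)\<^sup>2) ^ m" for \<omega>
    proof (cases "X \<omega> = 0")
      case False
      then have "\<bar>X \<omega>\<bar> powr real (2 * m) = \<bar>X \<omega>\<bar> ^ (2 * m)"
        by (intro powr_realpow) simp
      then show ?thesis by (simp add: power_mult)
    qed (use False in simp)
    have int_m: "integrable M (\<lambda>\<omega>. ((X \<omega>)\<^sup>2) ^ m)"
      using int[of "real (2 * m)"] False by (simp only: pw)
    have "expectation (\<lambda>\<omega>. ((X \<omega>)\<^sup>2) ^ m) \<le> (K * sqrt (real (2 * m))) powr real (2 * m)"
      using mom[of "real (2 * m)"] False by (simp only: pw)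
    also have "\<dots> = (K * sqrt (real (2 * m))) ^ (2 * m)"
      using K False by (intro powr_realpow) simp
    also have "\<dots> = (2 * K\<^sup>2 * real m) ^ m"
      by (simp add: power_mult power_mult_distrib)
    finally have E: "expectation (\<lambda>\<omega>. ((X \<omega>)\<^sup>2) ^ m) \<le> (2 * K\<^sup>2 * real m) ^ m" .
    have gm: "g m = (\<lambda>\<omega>. c ^ m / fact m * ((X \<omega>)\<^sup>2) ^ m)"
      by (simp add: g_def fun_eq_iff power_mult_distrib field_simps)
    have "(\<integral>\<^sup>+\<omega>. ennreal (g m \<omega>) \<partial>M) = ennreal (expectation (g m))"
      using int_m by (intro nn_integral_eq_integral AE_I2 g_nonneg) (simp add: gm)
    also have "\<dots> \<le> ennreal ((1 / 2) ^ m)"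
    proof (rule ennreal_leI)
      have "expectation (g m) \<le> c ^ m / fact m * (2 * K\<^sup>2 * real m) ^ m"
        unfolding gm using E c by (simp add: divide_right_mono mult_left_mono)
      also have "\<dots> = (2 * c * K\<^sup>2) ^ m * (real m ^ m / fact m)"
        by (simp add: power_mult_distrib)
      also have "\<dots> \<le> (2 * c * K\<^sup>2) ^ m * exp (real m)"
        using c by (intro mult_left_mono power_div_fact_le_exp) auto
      also have "\<dots> = (2 * c * K\<^sup>2 * exp 1) ^ m"
        by (simp add: power_mult_distrib flip: exp_of_nat_mult)
      also have "2 * c * K\<^sup>2 * exp 1 = 1 / 2"
        using K by (simp add: c_def)
      finally show "expectation (g m) \<le> (1 / 2) ^ m" .
    qed
    finally show ?thesis .
  qed (simp add: g_def emeasure_space_1)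
  \<comment> \<open>Nonnegative integrals commute with the series unconditionally; integrability
    then follows from finiteness.\<close>
  have "(\<integral>\<^sup>+\<omega>. ennreal (exp (c * (X \<omega>)\<^sup>2)) \<partial>M) = (\<integral>\<^sup>+\<omega>. (\<Sum>m. ennreal (g m \<omega>)) \<partial>M)"
  proof (rule nn_integral_cong)
    fix \<omega>
    have "(\<lambda>m. g m \<omega>) sums exp (c * (X \<omega>)\<^sup>2)"
      unfolding g_def by (rule exp_converges)
    from suminf_ennreal2[OF g_nonneg sums_summable[OF this]] sums_unique[OF this]
    show "ennreal (exp (c * (X \<omega>)\<^sup>2)) = (\<Sum>m. ennreal (g m \<omega>))"
      by metis
  qed
  also have "\<dots> = (\<Sum>m. \<integral>\<^sup>+\<omega>. ennreal (g m \<omega>) \<partial>M)"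
    by (intro nn_integral_suminf) (simp add: g_def)
  also have "\<dots> \<le> (\<Sum>m. ennreal ((1 / 2) ^ m))"
    by (intro suminf_le g_le) auto
  also have "\<dots> = ennreal (\<Sum>m. (1 / 2) ^ m)"
    by (intro suminf_ennreal2) (auto intro: summable_geometric)
  also have "(\<Sum>m. (1 / 2 :: real) ^ m) = 2"
    by (subst suminf_geometric) auto
  finally have nn: "(\<integral>\<^sup>+\<omega>. ennreal (exp (c * (X \<omega>)\<^sup>2)) \<partial>M) \<le> ennreal 2" .
  show int: "integrable M (\<lambda>\<omega>. exp (c * (X \<omega>)\<^sup>2))"
    by (rule integrableI_nonneg) (use nn in \<open>auto simp: less_top[symmetric] top_unique\<close>)
  show "expectation (\<lambda>\<omega>. exp (c * (X \<omega>)\<^sup>2)) \<le> 2"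
    using nn by (subst (asm) nn_integral_eq_integral[OF int]) (simp_all del: ennreal_numeral)
qed

lemma unit_vec_in_unit_sphere: "j < p \<Longrightarrow> unit_vec p j \<in> unit_sphere p"
  by (auto simp: unit_sphere_def l2_norm_def L2_set_def if_distrib[of "\<lambda>x. x\<^sup>2"] cong: if_cong)

text \<open>The supremum defining the vector norm is tested at a standard basis vector and at the
  single order \<open>q\<close>.\<close>

lemma coordinate_moment_le:
  assumes sg: "psi2_norm_vec M p X \<le> ereal K" and j: "j < p" and q: "1 \<le> q"
  shows "integrable M (\<lambda>\<omega>. \<bar>X \<omega> j\<bar> powr q)" and "(\<integral>\<omega>. \<bar>X \<omega> j\<bar> powr q \<partial>M) \<le> (K * sqrt q) powr q"
proof -
  have "ereal (q powr (- 1 / 2)) * Lq_norm M q (\<lambda>\<omega>. unit_vec p j \<bullet> vec p (X \<omega>)) \<le> psi2_norm_vec M p X"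
    unfolding psi2_norm_vec_def using q
    by (intro SUP_upper2[OF unit_vec_in_unit_sphere[OF j]] SUP_upper) auto
  also have "(\<lambda>\<omega>. unit_vec p j \<bullet> vec p (X \<omega>)) = (\<lambda>\<omega>. X \<omega> j)"
    using j by simp
  finally have le: "ereal (q powr (- 1 / 2)) * Lq_norm M q (\<lambda>\<omega>. X \<omega> j) \<le> ereal K"
    using sg by simp
  have qp: "0 < q powr (- 1 / 2)" using q by simp
  \<comment> \<open>\<open>Lq_norm\<close> takes the value \<infinity> when integrability fails, so
    a finite bound yields integrability.\<close>
  show int: "integrable M (\<lambda>\<omega>. \<bar>X \<omega> j\<bar> powr q)"
  proof (rule ccontr)
    assume "\<not> integrable M (\<lambda>\<omega>. \<bar>X \<omega> j\<bar> powr q)"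
    then have "Lq_norm M q (\<lambda>\<omega>. X \<omega> j) = \<infinity>" by (simp add: Lq_norm_def)
    with le qp show False by simp
  qed
  define m where "m = (\<integral>\<omega>. \<bar>X \<omega> j\<bar> powr q \<partial>M)"
  have m: "0 \<le> m" by (simp add: m_def)
  have "q powr (- 1 / 2) * m powr (1 / q) \<le> K"
    using le int by (simp add: Lq_norm_def m_def)
  moreover have "q powr (- 1 / 2) = 1 / sqrt q"
    using q by (simp add: powr_minus_divide powr_half_sqrt)
  ultimately have "m powr (1 / q) \<le> K * sqrt q"
    using q by (simp add: pos_divide_le_eq)
  then have "(m powr (1 / q)) powr q \<le> (K * sqrt q) powr q"
    using q by (intro powr_mono2) auto
  moreover have "(m powr (1 / q)) powr q = m"
    using q m by (simp add: powr_powr)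
  ultimately show "(\<integral>\<omega>. \<bar>X \<omega> j\<bar> powr q \<partial>M) \<le> (K * sqrt q) powr q"
    by (simp add: m_def)
qed

text \<open>Convexity of the exponential, by applying the midpoint inequality twice. It takes the
  place of Hoelder's inequality for a product of four factors.\<close>

lemma exp_average_le:
  fixes x\<^sub>1 x\<^sub>2 x\<^sub>3 x\<^sub>4 :: real
  shows "exp ((x\<^sub>1 + x\<^sub>2 + x\<^sub>3 + x\<^sub>4) / 4) \<le> (exp x\<^sub>1 + exp x\<^sub>2 + exp x\<^sub>3 + exp x\<^sub>4) / 4"
proof -
  have mid: "exp ((x + y) / 2) \<le> (exp x + exp y) / 2" for x y :: real
  proof -
    have "0 \<le> (exp (x / 2) - exp (y / 2))\<^sup>2" by simp
    also have "\<dots> = exp x + exp y - 2 * exp ((x + y) / 2)"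
      by (simp add: power2_eq_square add_divide_distrib algebra_simps flip: exp_add)
    finally show ?thesis by simp
  qed
  have "exp ((x\<^sub>1 + x\<^sub>2 + x\<^sub>3 + x\<^sub>4) / 4) = exp (((x\<^sub>1 + x\<^sub>2) / 2 + (x\<^sub>3 + x\<^sub>4) / 2) / 2)"
    by (simp add: field_simps)
  also have "\<dots> \<le> (exp ((x\<^sub>1 + x\<^sub>2) / 2) + exp ((x\<^sub>3 + x\<^sub>4) / 2)) / 2"
    by (rule mid)
  also have "\<dots> \<le> (exp x\<^sub>1 + exp x\<^sub>2 + exp x\<^sub>3 + exp x\<^sub>4) / 4"
    using mid[of x\<^sub>1 x\<^sub>2] mid[of x\<^sub>3 x\<^sub>4] by simp
  finally show ?thesis .
qed

text \<open>The factor \<open>2 * exp (4 * b + 2)\<close> bounds the exponential moment of the sum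
  of the two absolute deviations; \<open>exp (2 * exp (2 * b + 1))\<close> accounts for centering
  their product.\<close>

definition tail_const :: "real \<Rightarrow> real" where
  "tail_const b = 2 * exp (4 * b + 2 + 2 * exp (2 * b + 1))"

text \<open>By the arithmetic-geometric mean inequality
  \<open>sqrt \<bar>h \<omega>\<bar> \<le> H \<omega> / 2\<close>, where \<open>H\<close> adds the
  two absolute deviations. So \<open>exp (b * H \<omega>)\<close> is what must be integrated, and
  \<open>H\<close> is at most a constant plus four squares; averaging over these explains the factor
  4 in \<open>4 * b\<close>.\<close>

lemma (in prob_space) centered_product_exp_moment:
  fixes f g U\<^sub>1 U\<^sub>2 U\<^sub>3 U\<^sub>4 :: "'a \<Rightarrow> real"
  assumes b: "0 < b" and [measurable]: "f \<in> borel_measurable M" "g \<in> borel_measurable M"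
    and f: "\<And>\<omega>. \<bar>f \<omega>\<bar> \<le> 1 + (U\<^sub>1 \<omega>)\<^sup>2 + (U\<^sub>2 \<omega>)\<^sup>2" and g: "\<And>\<omega>. \<bar>g \<omega>\<bar> \<le> 1 + (U\<^sub>3 \<omega>)\<^sup>2 + (U\<^sub>4 \<omega>)\<^sup>2"
    and U: "\<And>U. U \<in> {U\<^sub>1, U\<^sub>2, U\<^sub>3, U\<^sub>4} \<Longrightarrow> U \<in> borel_measurable M"
      "\<And>U. U \<in> {U\<^sub>1, U\<^sub>2, U\<^sub>3, U\<^sub>4} \<Longrightarrow> integrable M (\<lambda>\<omega>. exp (4 * b * (U \<omega>)\<^sup>2))"
      "\<And>U. U \<in> {U\<^sub>1, U\<^sub>2, U\<^sub>3, U\<^sub>4} \<Longrightarrow> expectation (\<lambda>\<omega>. exp (4 * b * (U \<omega>)\<^sup>2)) \<le> 2"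
  defines "h \<equiv> \<lambda>\<omega>. (f \<omega> - expectation f) * (g \<omega> - expectation g)"
  defines "Y \<equiv> \<lambda>\<omega>. h \<omega> - expectation h"
  shows "integrable M f" "integrable M h"
    and "integrable M (\<lambda>\<omega>. exp (2 * b * sqrt \<bar>Y \<omega>\<bar>))"
    and "expectation (\<lambda>\<omega>. exp (2 * b * sqrt \<bar>Y \<omega>\<bar>)) \<le> tail_const b"
proof -
  note [measurable] = U(1)[of U\<^sub>1] U(1)[of U\<^sub>2] U(1)[of U\<^sub>3] U(1)[of U\<^sub>4]
  have sq_le: "x\<^sup>2 \<le> 1 / (4 * b) * exp (4 * b * x\<^sup>2)" for x :: real
  proof -
    have "4 * b * x\<^sup>2 \<le> exp (4 * b * x\<^sup>2)"
      using power_div_fact_le_exp[of "4 * b * x\<^sup>2" 1] b by simp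
    then show ?thesis using b by (simp add: field_simps)
  qed
  have sq: "integrable M (\<lambda>\<omega>. (V \<omega>)\<^sup>2)" "expectation (\<lambda>\<omega>. (V \<omega>)\<^sup>2) \<le> 1 / (2 * b)"
    if V: "V \<in> {U\<^sub>1, U\<^sub>2, U\<^sub>3, U\<^sub>4}" for V
  proof -
    note [measurable] = U(1)[OF V]
    have int: "integrable M (\<lambda>\<omega>. 1 / (4 * b) * exp (4 * b * (V \<omega>)\<^sup>2))"
      using U(2)[OF V] by simp
    show *: "integrable M (\<lambda>\<omega>. (V \<omega>)\<^sup>2)"
      by (rule Bochner_Integration.integrable_bound[OF int])
        (use order.trans[OF sq_le abs_ge_self] in auto)
    have "expectation (\<lambda>\<omega>. (V \<omega>)\<^sup>2) \<le> expectation (\<lambda>\<omega>. 1 / (4 * b) * exp (4 * b * (V \<omega>)\<^sup>2))"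
      by (intro integral_mono * int sq_le)
    also have "\<dots> = 1 / (4 * b) * expectation (\<lambda>\<omega>. exp (4 * b * (V \<omega>)\<^sup>2))"
      by simp
    also have "\<dots> \<le> 1 / (4 * b) * 2"
      using U(3)[OF V] b by (intro mult_left_mono) auto
    finally show "expectation (\<lambda>\<omega>. (V \<omega>)\<^sup>2) \<le> 1 / (2 * b)" by simp
  qed
  have mean: "integrable M k" "\<bar>expectation k\<bar> \<le> 1 + 1 / b"
    if k: "k \<in> borel_measurable M" "\<And>\<omega>. \<bar>k \<omega>\<bar> \<le> 1 + (V \<omega>)\<^sup>2 + (V' \<omega>)\<^sup>2"
      and V: "V \<in> {U\<^sub>1, U\<^sub>2, U\<^sub>3, U\<^sub>4}" "V' \<in> {U\<^sub>1, U\<^sub>2, U\<^sub>3, U\<^sub>4}" for k V V'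
  proof -
    have int: "integrable M (\<lambda>\<omega>. 1 + (V \<omega>)\<^sup>2 + (V' \<omega>)\<^sup>2)"
      by (intro Bochner_Integration.integrable_add sq V integrable_const)
    show *: "integrable M k"
      by (rule Bochner_Integration.integrable_bound[OF int])
        (use k order.trans[OF k(2) abs_ge_self] in auto)
    have "\<bar>expectation k\<bar> \<le> expectation (\<lambda>\<omega>. \<bar>k \<omega>\<bar>)" by simp
    also have "\<dots> \<le> expectation (\<lambda>\<omega>. 1 + (V \<omega>)\<^sup>2 + (V' \<omega>)\<^sup>2)"
      using * by (intro integral_mono int k) auto
    also have "\<dots> = 1 + expectation (\<lambda>\<omega>. (V \<omega>)\<^sup>2) + expectation (\<lambda>\<omega>. (V' \<omega>)\<^sup>2)"
      using sq(1)[OF V(1)] sq(1)[OF V(2)] by (simp add: prob_space)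
    also have "\<dots> \<le> 1 + 1 / b"
      using sq(2)[OF V(1)] sq(2)[OF V(2)] by simp
    finally show "\<bar>expectation k\<bar> \<le> 1 + 1 / b" .
  qed
  have mf: "integrable M f" "\<bar>expectation f\<bar> \<le> 1 + 1 / b"
    and mg: "integrable M g" "\<bar>expectation g\<bar> \<le> 1 + 1 / b"
    using mean[of f U\<^sub>1 U\<^sub>2] mean[of g U\<^sub>3 U\<^sub>4] f g by auto
  define H where "H \<omega> = \<bar>f \<omega> - expectation f\<bar> + \<bar>g \<omega> - expectation g\<bar>" for \<omega>
  define S where "S \<omega> = (exp (4 * b * (U\<^sub>1 \<omega>)\<^sup>2) + exp (4 * b * (U\<^sub>2 \<omega>)\<^sup>2)
    + exp (4 * b * (U\<^sub>3 \<omega>)\<^sup>2) + exp (4 * b * (U\<^sub>4 \<omega>)\<^sup>2)) / 4" for \<omega>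
  have [measurable]: "H \<in> borel_measurable M" "h \<in> borel_measurable M" "Y \<in> borel_measurable M"
    unfolding H_def h_def Y_def by measurable
  have S: "integrable M S" "expectation S \<le> 2"
    unfolding S_def using U(2,3)[of U\<^sub>1] U(2,3)[of U\<^sub>2] U(2,3)[of U\<^sub>3] U(2,3)[of U\<^sub>4] by auto
  have exp_H: "exp (b * H \<omega>) \<le> exp (4 * b + 2) * S \<omega>" for \<omega>
  proof -
    \<comment> \<open>The ones in the bounds for \<open>f\<close> and \<open>g\<close> contribute 2,
      and the two means contribute \<open>2 + 2 / b\<close>.\<close>
    have "H \<omega> \<le> 4 + 2 / b + ((U\<^sub>1 \<omega>)\<^sup>2 + (U\<^sub>2 \<omega>)\<^sup>2 + (U\<^sub>3 \<omega>)\<^sup>2 + (U\<^sub>4 \<omega>)\<^sup>2)"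
      using f[of \<omega>] g[of \<omega>] mf(2) mg(2) unfolding H_def by simp
    then have "b * H \<omega> \<le> b * (4 + 2 / b + ((U\<^sub>1 \<omega>)\<^sup>2 + (U\<^sub>2 \<omega>)\<^sup>2 + (U\<^sub>3 \<omega>)\<^sup>2 + (U\<^sub>4 \<omega>)\<^sup>2))"
      using b by (intro mult_left_mono) auto
    also have "\<dots> = 4 * b + 2 + (4 * b * (U\<^sub>1 \<omega>)\<^sup>2 + 4 * b * (U\<^sub>2 \<omega>)\<^sup>2 + 4 * b * (U\<^sub>3 \<omega>)\<^sup>2
        + 4 * b * (U\<^sub>4 \<omega>)\<^sup>2) / 4"
      using b by (simp add: field_simps)
    finally have "exp (b * H \<omega>) \<le> exp (4 * b + 2) * exp ((4 * b * (U\<^sub>1 \<omega>)\<^sup>2 + 4 * b * (U\<^sub>2 \<omega>)\<^sup>2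
        + 4 * b * (U\<^sub>3 \<omega>)\<^sup>2 + 4 * b * (U\<^sub>4 \<omega>)\<^sup>2) / 4)"
      by (simp flip: exp_add)
    also have "\<dots> \<le> exp (4 * b + 2) * S \<omega>"
      unfolding S_def by (intro mult_left_mono exp_average_le) simp
    finally show ?thesis .
  qed
  have iH: "integrable M (\<lambda>\<omega>. exp (b * H \<omega>))"
    by (rule Bochner_Integration.integrable_bound[where f="\<lambda>\<omega>. exp (4 * b + 2) * S \<omega>"])
      (use S order.trans[OF exp_H abs_ge_self] in auto)
  have "expectation (\<lambda>\<omega>. exp (b * H \<omega>)) \<le> expectation (\<lambda>\<omega>. exp (4 * b + 2) * S \<omega>)"
    using S by (intro integral_mono iH exp_H) auto
  also have "\<dots> \<le> exp (4 * b + 2) * 2"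
    using S by simp
  finally have EH: "expectation (\<lambda>\<omega>. exp (b * H \<omega>)) \<le> 2 * exp (4 * b + 2)" by simp
  have H_nonneg: "0 \<le> H \<omega>" for \<omega> by (simp add: H_def)
  have h_H: "\<bar>h \<omega>\<bar> \<le> (H \<omega> / 2)\<^sup>2" for \<omega>
  proof -
    have "0 \<le> (\<bar>f \<omega> - expectation f\<bar> - \<bar>g \<omega> - expectation g\<bar>)\<^sup>2" by simp
    then show ?thesis
      by (simp add: h_def H_def abs_mult power_divide power2_diff power2_sum)
  qed
  have h_exp: "\<bar>h \<omega>\<bar> \<le> 1 / (2 * b\<^sup>2) * exp (b * H \<omega>)" for \<omega>
  proof -
    have "(b * H \<omega>)\<^sup>2 / 2 \<le> exp (b * H \<omega>)"
      using power_div_fact_le_exp[of "b * H \<omega>" 2] H_nonneg[of \<omega>] b by simp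
    then have "(H \<omega>)\<^sup>2 / 4 \<le> 1 / (2 * b\<^sup>2) * exp (b * H \<omega>)"
      using b by (simp add: field_simps)
    with h_H[of \<omega>] show ?thesis by (simp add: power_divide)
  qed
  show ih: "integrable M h"
    by (rule Bochner_Integration.integrable_bound[where f="\<lambda>\<omega>. 1 / (2 * b\<^sup>2) * exp (b * H \<omega>)"])
      (use iH order.trans[OF h_exp abs_ge_self] in auto)
  have "\<bar>expectation h\<bar> \<le> expectation (\<lambda>\<omega>. \<bar>h \<omega>\<bar>)" by simp
  also have "\<dots> \<le> expectation (\<lambda>\<omega>. 1 / (2 * b\<^sup>2) * exp (b * H \<omega>))"
    using ih iH by (intro integral_mono h_exp) auto
  also have "\<dots> = 1 / (2 * b\<^sup>2) * expectation (\<lambda>\<omega>. exp (b * H \<omega>))"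
    by simp
  also have "\<dots> \<le> 1 / (2 * b\<^sup>2) * (2 * exp (4 * b + 2))"
    using EH b by (intro mult_left_mono) auto
  finally have Eh: "\<bar>expectation h\<bar> \<le> exp (4 * b + 2) / b\<^sup>2" by simp
  have "exp (2 * b + 1) ^ 2 = exp (4 * b + 2)"
    by (simp flip: exp_of_nat_mult exp_double)
  then have sqrt_Eh: "sqrt \<bar>expectation h\<bar> \<le> exp (2 * b + 1) / b"
    using Eh b by (intro real_le_lsqrt) (auto simp: power_divide)
  have Y_le: "exp (2 * b * sqrt \<bar>Y \<omega>\<bar>) \<le> exp (2 * exp (2 * b + 1)) * exp (b * H \<omega>)" for \<omega>
  proof -
    \<comment> \<open>Subadditivity of the square root separates the mean of \<open>h\<close>, which
      then costs only a constant factor in the exponential.\<close>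
    have "sqrt \<bar>Y \<omega>\<bar> \<le> sqrt (\<bar>h \<omega>\<bar> + \<bar>expectation h\<bar>)"
      unfolding Y_def by simp
    also have "\<dots> \<le> sqrt \<bar>h \<omega>\<bar> + sqrt \<bar>expectation h\<bar>"
      by (rule sqrt_add_le_add_sqrt) auto
    also have "\<dots> \<le> H \<omega> / 2 + exp (2 * b + 1) / b"
      using h_H[of \<omega>] H_nonneg[of \<omega>] by (intro add_mono sqrt_Eh real_le_lsqrt) auto
    finally have "2 * b * sqrt \<bar>Y \<omega>\<bar> \<le> 2 * b * (H \<omega> / 2 + exp (2 * b + 1) / b)"
      using b by (intro mult_left_mono) auto
    also have "\<dots> = 2 * exp (2 * b + 1) + b * H \<omega>"
      using b by (simp add: field_simps)
    finally show ?thesis by (simp flip: exp_add)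
  qed
  show iY: "integrable M (\<lambda>\<omega>. exp (2 * b * sqrt \<bar>Y \<omega>\<bar>))"
    by (rule Bochner_Integration.integrable_bound[where f="\<lambda>\<omega>. exp (2 * exp (2 * b + 1)) * exp (b * H \<omega>)"])
      (use iH order.trans[OF Y_le abs_ge_self] in auto)
  have "expectation (\<lambda>\<omega>. exp (2 * b * sqrt \<bar>Y \<omega>\<bar>)) \<le> expectation (\<lambda>\<omega>. exp (2 * exp (2 * b + 1)) * exp (b * H \<omega>))"
    using iH by (intro integral_mono iY Y_le) auto
  also have "\<dots> \<le> exp (2 * exp (2 * b + 1)) * (2 * exp (4 * b + 2))"
    using EH by simp
  also have "\<dots> = tail_const b"
    by (simp add: tail_const_def exp_add)
  finally show "expectation (\<lambda>\<omega>. exp (2 * b * sqrt \<bar>Y \<omega>\<bar>)) \<le> tail_const b" .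
  show "integrable M f" by (rule mf)
qed

section \<open>Entries of the design vector\<close>

lemma dim_z_eq: "dim_z p = p + length (inter_pairs p)"
  using length_inter_pairs[of p] by (simp add: dim_z_def)

lemma zraw_entry_cases:
  assumes "l < dim_z p"
  obtains (main) j where "j < p" "\<And>x. zraw p x $ l = x j"
    | (inter) j k where "j < p" "k < p" "\<And>x. zraw p x $ l = x j * x k"
proof (cases "l < p")
  case True
  then have "zraw p x $ l = x l" for x by (simp add: zraw_def)
  with True show ?thesis by (rule main)
next
  case False
  with assms have l: "l - p < length (inter_pairs p)" by (simp add: dim_z_eq)
  obtain j k where jk: "inter_pairs p ! (l - p) = (j, k)" by fastforce
  then have "(j, k) \<in> set (inter_pairs p)" using l by (metis nth_mem)
  then have "j < p" "k < p" by (auto simp: inter_pairs_def)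
  moreover have "zraw p x $ l = x j * x k" for x
    using False l jk by (simp add: zraw_def vec_of_list_index)
  ultimately show ?thesis by (rule inter)
qed

lemma borel_measurable_zraw:
  assumes "l < dim_z p"
  shows "(\<lambda>x. zraw p x $ l) \<in> borel_measurable (rvec_space p)"
proof -
  have [measurable]: "j < p \<Longrightarrow> (\<lambda>x. x j) \<in> borel_measurable (rvec_space p)" for j
    unfolding rvec_space_def by (rule measurable_component_singleton) simp
  show ?thesis by (rule zraw_entry_cases[OF assms]) simp_all
qed

text \<open>Main effects, with the same coordinate taken twice, and interactions get one common
  bound, so that all types of covariance entries are handled by a single moment estimate.\<close>

lemma zraw_bound:
  assumes "l < dim_z p"
  obtains j k where "j < p" "k < p" "\<And>x. \<bar>zraw p x $ l\<bar> \<le> 1 + (x j)\<^sup>2 + (x k)\<^sup>2"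
  using assms
proof (cases rule: zraw_entry_cases)
  case (main j)
  have "\<bar>y\<bar> \<le> 1 + y\<^sup>2 + y\<^sup>2" for y :: real
  proof -
    have "0 \<le> (\<bar>y\<bar> - 1)\<^sup>2" by simp
    then have "2 * \<bar>y\<bar> \<le> 1 + y\<^sup>2" by (simp add: power2_diff)
    then show ?thesis using zero_le_power2[of y] by linarith
  qed
  with main show ?thesis by (intro that[of j j]) auto
next
  case (inter j k)
  have "\<bar>y * z\<bar> \<le> 1 + y\<^sup>2 + z\<^sup>2" for y z :: real
  proof -
    have "0 \<le> (\<bar>y\<bar> - \<bar>z\<bar>)\<^sup>2" by simp
    then have "2 * \<bar>y * z\<bar> \<le> y\<^sup>2 + z\<^sup>2" by (simp add: power2_diff abs_mult)
    then show ?thesis using abs_ge_zero[of "y * z"] by linarith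
  qed
  with inter show ?thesis by (intro that[of j k]) auto
qed

section \<open>From the generic copy to the sample, and the union bound\<close>

text \<open>Both sides are integrals against the common law. This carries moment facts from
  \<open>X 0\<close> to the observations.\<close>

lemma distr_eq_transfer:
  fixes \<phi> :: "'b \<Rightarrow> real"
  assumes "distr M N X = distr M N X'" "X \<in> measurable M N" "X' \<in> measurable M N"
    and "\<phi> \<in> borel_measurable N"
  shows "integrable M (\<lambda>\<omega>. \<phi> (X \<omega>)) \<longleftrightarrow> integrable M (\<lambda>\<omega>. \<phi> (X' \<omega>))"
    and "(\<integral>\<omega>. \<phi> (X \<omega>) \<partial>M) = (\<integral>\<omega>. \<phi> (X' \<omega>) \<partial>M)"
  using assms by (simp_all flip: integrable_distr_eq integral_distr)

text \<open>There is one bad event for each entry of the covariance matrix and each sign of the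
  deviation, which gives the factor \<open>2 * (dim_z p)\<^sup>2\<close>. Outside their union the
  deterministic criterion applies.\<close>

lemma (in prob_space) RE_probability_ge:
  fixes X :: "nat \<Rightarrow> 'a \<Rightarrow> nat \<Rightarrow> real"
  assumes iid: "iid_model M p n X" and sg: "psi2_norm_vec M p (X 0) \<le> ereal K" and K: "0 < K"
    and b: "b = 1 / (16 * exp 1 * K\<^sup>2)"
    and a: "0 < a" "a \<le> lambda_min_z M p (X 0)" and k\<^sub>0: "0 \<le> k\<^sub>0"
    and \<tau>: "0 \<le> \<tau>" "2 * \<tau> * real s * (1 + k\<^sub>0)\<^sup>2 \<le> a"
    and N: "0 < N" "N ^ 3 = real n"
  defines "D \<equiv> tail_const b"
  shows "prob {\<omega> \<in> space M. re_const (design_matrix M p n X \<omega>) k\<^sub>0 s > 0}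
    \<ge> 1 - 2 * (real (dim_z p))\<^sup>2 * (real n * D * exp (- (2 * b * N))
      + exp (12 * D / b\<^sup>2 * N + 24 * D / b ^ 3 - b * N\<^sup>2 * \<tau>))"
proof -
  define d where "d = dim_z p"
  have n: "0 < n" using N by (cases n) auto
  have b_pos: "0 < b" using K by (simp add: b)
  have indep: "indep_vars (\<lambda>_. rvec_space p) X {0..n}"
    and same: "\<And>i. i \<in> {0..n} \<Longrightarrow> distr M (rvec_space p) (X i) = distr M (rvec_space p) (X 0)"
    using iid unfolding iid_model_def by blast+
  have X [measurable]: "X i \<in> measurable M (rvec_space p)" if "i \<in> {0..n}" for i
    using indep that by (auto simp: indep_vars_def)
  note transfer = distr_eq_transfer[OF same X X]
  \<comment> \<open>All quantities are written as fixed functions on \<open>rvec_space p\<close>, so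
    that independence and equality of laws pass to them by composition.\<close>
  define g where "g l x = zraw p x $ l" for l x
  have [measurable]: "g l \<in> borel_measurable (rvec_space p)" if "l < d" for l
    using borel_measurable_zraw that by (simp add: g_def[abs_def] d_def)
  define \<mu> where "\<mu> l = expectation (\<lambda>\<omega>. g l (X 0 \<omega>))" for l
  define h where "h l x = g l x - \<mu> l" for l x
  have [measurable]: "h l \<in> borel_measurable (rvec_space p)" if "l < d" for l
    unfolding h_def[abs_def] using that by measurable
  define m where "m i j = expectation (\<lambda>\<omega>. h i (X 0 \<omega>) * h j (X 0 \<omega>))" for i j
  define \<phi> where "\<phi> i j x = h i x * h j x - m i j" for i j x
  have [measurable]: "\<phi> i j \<in> borel_measurable (rvec_space p)" if "i < d" "j < d" for i j
    unfolding \<phi>_def[abs_def] using that by measurable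
  \<comment> \<open>\<open>zvec\<close> centers each observation by its own expectation; equality of
    laws turns this into the mean of the generic copy.\<close>
  have zvec: "zvec M p (X r) \<omega> $ l = h l (X r \<omega>)" if "r \<in> {0..n}" "l < d" for r l \<omega>
  proof -
    have "expectation (\<lambda>\<omega>. g l (X r \<omega>)) = \<mu> l"
      unfolding \<mu>_def using that by (intro transfer) auto
    then show ?thesis
      using that by (simp add: zvec_def h_def g_def d_def)
  qed

  have coord: "(\<lambda>\<omega>. X 0 \<omega> j) \<in> borel_measurable M"
    "integrable M (\<lambda>\<omega>. exp (4 * b * (X 0 \<omega> j)\<^sup>2))"
    "expectation (\<lambda>\<omega>. exp (4 * b * (X 0 \<omega> j)\<^sup>2)) \<le> 2" if "j < p" for j
  proof -
    have "(\<lambda>x. x j) \<in> borel_measurable (rvec_space p)"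
      unfolding rvec_space_def by (rule measurable_component_singleton) (use that in simp)
    then show meas: "(\<lambda>\<omega>. X 0 \<omega> j) \<in> borel_measurable M"
      using X[of 0] by (auto intro: measurable_compose)
    \<comment> \<open>The value of \<open>b\<close> is chosen so that \<open>4 * b\<close> is the
      exponent of \<open>exp_square_moment_le\<close>.\<close>
    have "4 * b = 1 / (4 * exp 1 * K\<^sup>2)" by (simp add: b)
    then show "integrable M (\<lambda>\<omega>. exp (4 * b * (X 0 \<omega> j)\<^sup>2))"
      "expectation (\<lambda>\<omega>. exp (4 * b * (X 0 \<omega> j)\<^sup>2)) \<le> 2"
      using exp_square_moment_le[OF K meas] coordinate_moment_le[OF sg that] by simp_all
  qed
  have base: "integrable M (\<lambda>\<omega>. g i (X 0 \<omega>))" "integrable M (\<lambda>\<omega>. h i (X 0 \<omega>) * h j (X 0 \<omega>))"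
    "integrable M (\<lambda>\<omega>. exp (2 * b * sqrt \<bar>\<phi> i j (X 0 \<omega>)\<bar>))"
    "expectation (\<lambda>\<omega>. exp (2 * b * sqrt \<bar>\<phi> i j (X 0 \<omega>)\<bar>)) \<le> D"
    if ij: "i < d" "j < d" for i j
  proof -
    obtain i1 i2 where i: "i1 < p" "i2 < p" "\<And>x. \<bar>g i x\<bar> \<le> 1 + (x i1)\<^sup>2 + (x i2)\<^sup>2"
      using zraw_bound[of i p] ij by (auto simp: d_def g_def)
    obtain j1 j2 where j: "j1 < p" "j2 < p" "\<And>x. \<bar>g j x\<bar> \<le> 1 + (x j1)\<^sup>2 + (x j2)\<^sup>2"
      using zraw_bound[of j p] ij by (auto simp: d_def g_def)
    have gm: "(\<lambda>\<omega>. g l (X 0 \<omega>)) \<in> borel_measurable M" if "l < d" for l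
      using that X[of 0] by measurable
    note * = centered_product_exp_moment[OF b_pos gm[OF ij(1)] gm[OF ij(2)] i(3) j(3)]
    show "integrable M (\<lambda>\<omega>. g i (X 0 \<omega>))" "integrable M (\<lambda>\<omega>. h i (X 0 \<omega>) * h j (X 0 \<omega>))"
      "integrable M (\<lambda>\<omega>. exp (2 * b * sqrt \<bar>\<phi> i j (X 0 \<omega>)\<bar>))"
      "expectation (\<lambda>\<omega>. exp (2 * b * sqrt \<bar>\<phi> i j (X 0 \<omega>)\<bar>)) \<le> D"
      unfolding \<phi>_def m_def h_def \<mu>_def D_def
      by (rule *; use coord i j in blast)+
  qed
  have h_mean: "expectation (\<lambda>\<omega>. h l (X 0 \<omega>)) = 0" if "l < d" for l
    using base(1)[OF that that] by (simp add: h_def \<mu>_def prob_space)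
  have \<phi>: "integrable M (\<lambda>\<omega>. \<phi> i j (X r \<omega>))" "expectation (\<lambda>\<omega>. \<phi> i j (X r \<omega>)) = 0"
    "integrable M (\<lambda>\<omega>. exp (2 * b * sqrt \<bar>\<phi> i j (X r \<omega>)\<bar>))"
    "expectation (\<lambda>\<omega>. exp (2 * b * sqrt \<bar>\<phi> i j (X r \<omega>)\<bar>)) \<le> D"
    if ij: "i < d" "j < d" and r: "r \<in> {0..n}" for i j r
  proof -
    have "integrable M (\<lambda>\<omega>. \<phi> i j (X 0 \<omega>))" "expectation (\<lambda>\<omega>. \<phi> i j (X 0 \<omega>)) = 0"
      unfolding \<phi>_def using base(2)[OF ij] by (auto simp: m_def prob_space)
    then show "integrable M (\<lambda>\<omega>. \<phi> i j (X r \<omega>))" "expectation (\<lambda>\<omega>. \<phi> i j (X r \<omega>)) = 0"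
      using transfer[of r "\<phi> i j"] ij r by auto
    have "(\<lambda>x. exp (2 * b * sqrt \<bar>\<phi> i j x\<bar>)) \<in> borel_measurable (rvec_space p)"
      using ij by measurable
    from transfer[OF r r _ this]
    show "integrable M (\<lambda>\<omega>. exp (2 * b * sqrt \<bar>\<phi> i j (X r \<omega>)\<bar>))"
      "expectation (\<lambda>\<omega>. exp (2 * b * sqrt \<bar>\<phi> i j (X r \<omega>)\<bar>)) \<le> D"
      using base(3,4)[OF ij] by auto
  qed

  define bound where "bound = real n * D * exp (- (2 * b * N))
    + exp (12 * D / b\<^sup>2 * N + 24 * D / b ^ 3 - b * N\<^sup>2 * \<tau>)"
  define Bad where "Bad \<sigma> i j = {\<omega> \<in> space M. (\<Sum>r\<in>{1..n}. \<sigma> * \<phi> i j (X r \<omega>)) \<ge> real n * \<tau>}"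
    for \<sigma> i j
  have Bad: "Bad \<sigma> i j \<in> events" "prob (Bad \<sigma> i j) \<le> bound"
    if ij: "i < d" "j < d" and \<sigma>: "\<sigma> \<in> {1, -1}" for \<sigma> i j
  proof -
    have "(\<lambda>\<omega>. \<phi> i j (X r \<omega>)) \<in> borel_measurable M" if "r \<in> {1..n}" for r
      using \<phi>(1)[OF ij, of r] that by auto
    then show "Bad \<sigma> i j \<in> events"
      unfolding Bad_def by measurable
    have "indep_vars (\<lambda>_. borel) (\<lambda>r \<omega>. \<sigma> * \<phi> i j (X r \<omega>)) {1..n}"
      by (rule indep_vars_compose2[OF indep_vars_subset[OF indep]]) (use ij in auto)
    moreover have "\<bar>\<sigma> * y\<bar> = \<bar>y\<bar>" for y using \<sigma> by (auto simp: abs_mult)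
    ultimately show "prob (Bad \<sigma> i j) \<le> bound"
      unfolding Bad_def bound_def
      by (intro sum_tail_bound b_pos N) (use \<phi>[OF ij] in auto)
  qed

  define \<Sigma> where "\<Sigma> = Sigma_z M p (X 0)"
  have \<Sigma>_carrier: "\<Sigma> \<in> carrier_mat d d" by (simp add: \<Sigma>_def Sigma_z_def d_def)
  \<comment> \<open>The covariance subtracts the means of already centered entries, which are
    zero.\<close>
  have \<Sigma>_entry: "\<Sigma> $$ (i, j) = m i j" if "i < d" "j < d" for i j
    using that by (simp add: \<Sigma>_def Sigma_z_def d_def[symmetric] covariance_def zvec h_mean m_def)
  have "transpose_mat \<Sigma> = \<Sigma>"
    using \<Sigma>_carrier by (intro eq_matI) (auto simp: \<Sigma>_entry m_def mult.commute)
  then have lower: "a * (v \<bullet> v) \<le> v \<bullet> (\<Sigma> *\<^sub>v v)" if "v \<in> carrier_vec d" for v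
  proof -
    have "a * (v \<bullet> v) \<le> lambda_min_z M p (X 0) * (v \<bullet> v)"
      using a that by (intro mult_right_mono) (auto simp: scalar_prod_self_eq sum_nonneg)
    also have "\<dots> \<le> v \<bullet> (\<Sigma> *\<^sub>v v)"
      unfolding lambda_min_z_def \<Sigma>_def[symmetric]
      by (rule Min_spectrum_le_quadratic_form) fact+
    finally show ?thesis .
  qed

  define A where "A \<omega> = design_matrix M p n X \<omega>" for \<omega>
  have A_carrier: "A \<omega> \<in> carrier_mat n d" for \<omega>
    by (rule carrier_matI) (simp_all add: A_def design_matrix_def d_def del: upt_Suc)
  \<comment> \<open>Row \<open>r\<close> holds observation \<open>Suc r\<close>, since index 0 is
    reserved for the generic copy.\<close>
  have A_entry: "A \<omega> $$ (r, l) = h l (X (Suc r) \<omega>)" if "r < n" "l < d" for r l \<omega>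
    using that by (simp add: A_def design_matrix_def d_def[symmetric] mat_of_rows_index zvec del: upt_Suc)
  define Good where "Good = {\<omega> \<in> space M. re_const (A \<omega>) k\<^sub>0 s > 0}"
  have "(\<lambda>\<omega>. re_const (A \<omega>) k\<^sub>0 s) \<in> borel_measurable M"
  proof (rule borel_measurable_re_const[OF A_carrier n k\<^sub>0])
    fix i j assume ij: "i < n" "j < d"
    then have "(\<lambda>\<omega>. h j (X (Suc i) \<omega>)) \<in> borel_measurable M" by measurable (use ij in auto)
    then show "(\<lambda>\<omega>. A \<omega> $$ (i, j)) \<in> borel_measurable M" using ij by (simp add: A_entry)
  qed
  then have Good: "Good \<in> events" unfolding Good_def by measurable
  have "space M - Good \<subseteq> (\<Union>(i, j)\<in>{..<d} \<times> {..<d}. Bad 1 i j \<union> Bad (- 1) i j)"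
  proof (rule ccontr)
    assume "\<not> ?thesis"
    then obtain \<omega> where \<omega>: "\<omega> \<in> space M" "\<omega> \<notin> Good"
      and nb: "\<And>i j. i < d \<Longrightarrow> j < d \<Longrightarrow> \<omega> \<notin> Bad 1 i j \<and> \<omega> \<notin> Bad (- 1) i j" by auto
    have "0 < re_const (A \<omega>) k\<^sub>0 s"
    proof (rule re_const_pos[OF A_carrier n \<Sigma>_carrier a(1) k\<^sub>0 lower _ \<tau>])
      fix i j assume ij: "i < d" "j < d"
      have "(\<Sum>r\<in>{1..n}. \<phi> i j (X r \<omega>)) = (\<Sum>r<n. \<phi> i j (X (Suc r) \<omega>))"
        using sum.atLeast1_atMost_eq[of "\<lambda>r. \<phi> i j (X r \<omega>)" n] by simp
      also have "\<dots> = (\<Sum>r<n. A \<omega> $$ (r, i) * A \<omega> $$ (r, j)) - real n * m i j"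
        using ij by (simp add: A_entry \<phi>_def sum_subtractf)
      finally have "(\<Sum>r\<in>{1..n}. \<phi> i j (X r \<omega>)) / real n
          = (\<Sum>r<n. A \<omega> $$ (r, i) * A \<omega> $$ (r, j)) / real n - \<Sigma> $$ (i, j)"
        using n ij by (simp add: \<Sigma>_entry diff_divide_distrib)
      moreover have "\<bar>\<Sum>r\<in>{1..n}. \<phi> i j (X r \<omega>)\<bar> \<le> real n * \<tau>"
        using nb[OF ij] \<omega>(1) by (auto simp: Bad_def sum_negf)
      then have "\<bar>(\<Sum>r\<in>{1..n}. \<phi> i j (X r \<omega>)) / real n\<bar> \<le> \<tau>"
        using n by (simp add: abs_divide pos_divide_le_eq mult.commute)
      ultimately show "\<bar>(\<Sum>r<n. A \<omega> $$ (r, i) * A \<omega> $$ (r, j)) / real n - \<Sigma> $$ (i, j)\<bar> \<le> \<tau>"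
        by simp
    qed
    with \<omega> show False by (simp add: Good_def)
  qed
  then have "prob (space M - Good) \<le> prob (\<Union>(i, j)\<in>{..<d} \<times> {..<d}. Bad 1 i j \<union> Bad (- 1) i j)"
    using Bad(1) by (intro finite_measure_mono) auto
  also have "\<dots> \<le> (\<Sum>(i, j)\<in>{..<d} \<times> {..<d}. prob (Bad 1 i j \<union> Bad (- 1) i j))"
    unfolding case_prod_unfold by (intro finite_measure_subadditive_finite) (use Bad(1) in auto)
  also have "\<dots> \<le> (\<Sum>(i, j)\<in>{..<d} \<times> {..<d}. 2 * bound)"
  proof (rule sum_mono)
    fix ij assume "ij \<in> {..<d} \<times> {..<d}"
    then obtain i j where ij: "ij = (i, j)" "i < d" "j < d" by auto
    have "prob (Bad 1 i j \<union> Bad (- 1) i j) \<le> prob (Bad 1 i j) + prob (Bad (- 1) i j)"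
      using Bad(1)[OF ij(2,3)] by (intro measure_Un_le) auto
    also have "\<dots> \<le> 2 * bound"
      using Bad(2)[OF ij(2,3), of 1] Bad(2)[OF ij(2,3), of "- 1"] by simp
    finally show "(case ij of (i, j) \<Rightarrow> prob (Bad 1 i j \<union> Bad (- 1) i j))
        \<le> (case ij of (i, j) \<Rightarrow> 2 * bound)"
      by (simp add: ij)
  qed
  also have "\<dots> = 2 * (real d)\<^sup>2 * bound"
    by (simp add: power2_eq_square)
  finally have "1 - prob Good \<le> 2 * (real d)\<^sup>2 * bound"
    using Good by (simp add: prob_compl)
  then show ?thesis
    by (simp add: Good_def A_def d_def bound_def)
qed

subsection \<open>Choice of the constants\<close>

lemma tail_const_pos: "0 < tail_const b"
  by (simp add: tail_const_def)

text \<open>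
  The three summands of \<open>c\<^sub>1\<close> serve, in this order, to make \<open>c\<^sub>1 \<ge> 1\<close>, to let the deviation term beat the
  error of the truncated moment generating function, and to absorb the union bound over the \<open>d\<^sup>2\<close> entries.
\<close>

lemma tail_sum_le:
  fixes b D N y d \<epsilon>\<^sub>3 c\<^sub>1 m\<^sub>1 a n :: real
  assumes b: "0 < b" and D: "0 < D" and a: "0 < a" and \<epsilon>\<^sub>3: "0 < \<epsilon>\<^sub>3" and N: "1 \<le> N" "N ^ 3 = n"
    and d: "1 \<le> d" and m: "16 \<le> m\<^sub>1"
    and c\<^sub>1: "c\<^sub>1 = 1 + \<epsilon>\<^sub>3 * (12 * D / b\<^sup>2 + 24 * D / b ^ 3 + 2 * b) / (8 * a * b) + 4 * \<epsilon>\<^sub>3 / b"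
    and large: "c\<^sub>1 * m\<^sub>1 * ln (c\<^sub>1 * m\<^sub>1 * d) < \<epsilon>\<^sub>3 * N"
  shows "2 * d\<^sup>2 * (n * D * exp (- (2 * b * N))
      + exp (12 * D / b\<^sup>2 * N + 24 * D / b ^ 3 - b * N\<^sup>2 * (8 * a / m\<^sub>1)))
    \<le> 2 * ((D + 1) * 48 / b ^ 3) * exp (- (b * N))"
proof -
  define C where "C = 12 * D / b\<^sup>2 + 24 * D / b ^ 3"
  have C: "0 < C" using b D by (simp add: C_def add_pos_pos)
  have frac: "0 \<le> \<epsilon>\<^sub>3 * (C + 2 * b) / (8 * a * b)" "0 \<le> 4 * \<epsilon>\<^sub>3 / b"
    using b a \<epsilon>\<^sub>3 C by auto
  have c1: "1 \<le> c\<^sub>1" "\<epsilon>\<^sub>3 * (C + 2 * b) / (8 * a * b) \<le> c\<^sub>1" "4 * \<epsilon>\<^sub>3 / b \<le> c\<^sub>1"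
    using frac unfolding c\<^sub>1 C_def[symmetric] by linarith+
  have cm: "16 \<le> c\<^sub>1 * m\<^sub>1"
    using mult_mono[of 1 c\<^sub>1 16 m\<^sub>1] c1 m by simp
  have cmd: "16 \<le> c\<^sub>1 * m\<^sub>1 * d" "d \<le> c\<^sub>1 * m\<^sub>1 * d"
    using mult_mono[of 16 "c\<^sub>1 * m\<^sub>1" 1 d] mult_right_mono[of 1 "c\<^sub>1 * m\<^sub>1" d] cm d by auto
  \<comment> \<open>A logarithm of at least 1 lets the hypothesis \<open>large\<close> bound
    \<open>c\<^sub>1 * m\<^sub>1\<close> alone as well.\<close>
  have "exp 1 \<le> c\<^sub>1 * m\<^sub>1 * d"
    using exp_le cmd by linarith
  then have ln1: "1 \<le> ln (c\<^sub>1 * m\<^sub>1 * d)"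
    using cmd by (subst ln_ge_iff) auto
  have lnd: "ln d \<le> ln (c\<^sub>1 * m\<^sub>1 * d)"
    using cmd d by simp
  have "c\<^sub>1 * m\<^sub>1 * 1 \<le> c\<^sub>1 * m\<^sub>1 * ln (c\<^sub>1 * m\<^sub>1 * d)"
    using ln1 cm by (intro mult_left_mono) auto
  then have L1: "c\<^sub>1 * m\<^sub>1 \<le> \<epsilon>\<^sub>3 * N" using large by simp
  have "c\<^sub>1 * ln d \<le> c\<^sub>1 * m\<^sub>1 * ln (c\<^sub>1 * m\<^sub>1 * d)"
    using c1 m lnd d by (intro mult_mono) auto
  then have L2: "c\<^sub>1 * ln d \<le> \<epsilon>\<^sub>3 * N" using large by simp

  \<comment> \<open>The second summand of \<open>c\<^sub>1\<close> makes the deviation term exceed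
    the error \<open>C * N\<close> by at least \<open>2 * b * N\<close>, the exponent of the
    truncation term.\<close>
  have "\<epsilon>\<^sub>3 * (C + 2 * b) / (8 * a * b) * m\<^sub>1 \<le> c\<^sub>1 * m\<^sub>1"
    using c1 m by (intro mult_right_mono) auto
  also note L1
  finally have "\<epsilon>\<^sub>3 * ((C + 2 * b) / (8 * a * b) * m\<^sub>1) \<le> \<epsilon>\<^sub>3 * N" by simp
  then have "(C + 2 * b) / (8 * a * b) * m\<^sub>1 \<le> N" using \<epsilon>\<^sub>3 by (simp only: mult_le_cancel_left_pos)
  then have CN: "C + 2 * b \<le> b * N * (8 * a / m\<^sub>1)"
    using a b m by (simp add: field_simps)
  have "12 * D / b\<^sup>2 * N + 24 * D / b ^ 3 * 1 \<le> 12 * D / b\<^sup>2 * N + 24 * D / b ^ 3 * N"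
    using b D N by (intro add_left_mono mult_left_mono) auto
  then have "12 * D / b\<^sup>2 * N + 24 * D / b ^ 3 \<le> C * N"
    by (simp add: C_def distrib_right)
  moreover have "(C + 2 * b) * N \<le> b * N * (8 * a / m\<^sub>1) * N"
    using CN N by (intro mult_right_mono) auto
  ultimately have "12 * D / b\<^sup>2 * N + 24 * D / b ^ 3 - b * N\<^sup>2 * (8 * a / m\<^sub>1) \<le> - (2 * b * N)"
    by (simp add: power2_eq_square algebra_simps)
  then have e1: "exp (12 * D / b\<^sup>2 * N + 24 * D / b ^ 3 - b * N\<^sup>2 * (8 * a / m\<^sub>1)) \<le> exp (- (2 * b * N))"
    by simp

  \<comment> \<open>The third summand of \<open>c\<^sub>1\<close> gives
    \<open>2 * ln d \<le> b * N / 2\<close>, so the union bound costs at most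
    \<open>exp (b * N / 2)\<close>.\<close>
  have "4 * \<epsilon>\<^sub>3 / b * ln d \<le> c\<^sub>1 * ln d"
    using c1 d by (intro mult_right_mono) auto
  also note L2
  finally have "\<epsilon>\<^sub>3 * (4 / b * ln d) \<le> \<epsilon>\<^sub>3 * N" by (simp add: mult_ac)
  then have "4 / b * ln d \<le> N" using \<epsilon>\<^sub>3 by (simp only: mult_le_cancel_left_pos)
  then have "2 * ln d \<le> b * N / 2" using b by (simp add: field_simps)
  then have "exp (2 * ln d) \<le> exp (b * N / 2)" by simp
  then have d2: "d\<^sup>2 \<le> exp (b * N / 2)"
    using d by (simp add: exp_double)
  have n1: "1 \<le> n" using N by auto
  \<comment> \<open>The factor \<open>n = N ^ 3\<close> costs another
    \<open>exp (b * N / 2)\<close>, by the cubic term of the series; 48 is 6 times 8. Of the decay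
    \<open>exp (- (2 * b * N))\<close> there remains \<open>exp (- (b * N))\<close>.\<close>
  have "(b * N / 2) ^ 3 / 6 \<le> exp (b * N / 2)"
    using power_div_fact_le_exp[of "b * N / 2" 3] b N by (simp add: fact_numeral)
  then have n3: "n \<le> 48 / b ^ 3 * exp (b * N / 2)"
    using b N(2) by (simp add: field_simps power_mult_distrib)
  have "n * D * exp (- (2 * b * N)) + exp (12 * D / b\<^sup>2 * N + 24 * D / b ^ 3 - b * N\<^sup>2 * (8 * a / m\<^sub>1))
    \<le> n * D * exp (- (2 * b * N)) + n * exp (- (2 * b * N))"
    using n1 by (intro add_left_mono order.trans[OF e1]) simp
  also have "\<dots> = n * ((D + 1) * exp (- (2 * b * N)))" by (simp add: algebra_simps)
  also have "\<dots> \<le> 48 / b ^ 3 * exp (b * N / 2) * ((D + 1) * exp (- (2 * b * N)))"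
    using D by (intro mult_right_mono n3) auto
  finally have "d\<^sup>2 * (n * D * exp (- (2 * b * N))
      + exp (12 * D / b\<^sup>2 * N + 24 * D / b ^ 3 - b * N\<^sup>2 * (8 * a / m\<^sub>1)))
    \<le> exp (b * N / 2) * (48 / b ^ 3 * exp (b * N / 2) * ((D + 1) * exp (- (2 * b * N))))"
    using d2 D n1 by (intro mult_mono) auto
  also have "\<dots> = (D + 1) * 48 / b ^ 3 * (exp (b * N / 2) * exp (b * N / 2) * exp (- (2 * b * N)))"
    by simp
  also have "exp (b * N / 2) * exp (b * N / 2) * exp (- (2 * b * N)) = exp (- (b * N))"
    by (simp flip: exp_add)
  finally show ?thesis unfolding mult.assoc by (intro mult_left_mono) auto
qed

lemma tendsto_one_minus_exp_powr:
  fixes c \<epsilon> \<delta> :: real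
  assumes "0 < \<epsilon>" "0 < \<delta>"
  shows "(\<lambda>n. 1 - 2 * c * exp (- (real n powr (1 / 3) * \<epsilon> powr (1 / 3) * \<delta>))) \<longlonglongrightarrow> 1"
proof -
  have "filterlim (\<lambda>n. real n powr (1 / 3)) at_top sequentially"
    by real_asymp
  then have "filterlim (\<lambda>n. (\<epsilon> powr (1 / 3) * \<delta>) * real n powr (1 / 3)) at_top sequentially"
    using assms by (intro filterlim_tendsto_pos_mult_at_top[OF tendsto_const]) auto
  then have "filterlim (\<lambda>n. - ((\<epsilon> powr (1 / 3) * \<delta>) * real n powr (1 / 3))) at_bot sequentially"
    by (simp add: filterlim_uminus_at_bot)
  then have "(\<lambda>n. exp (- ((\<epsilon> powr (1 / 3) * \<delta>) * real n powr (1 / 3)))) \<longlonglongrightarrow> 0"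
    by (rule filterlim_compose[OF exp_at_bot])
  from tendsto_diff[OF tendsto_const[of 1] tendsto_mult[OF tendsto_const[of "2 * c"] this]]
  show ?thesis by (simp add: mult_ac)
qed

theorem theorem3p1:
  fixes K\<^sub>x a\<^sub>1 a\<^sub>2 \<rho>bar K\<^sub>u k\<^sub>0 \<epsilon> :: real
  assumes "k\<^sub>0 > 0" and "\<epsilon> > 0"
  shows "\<exists>c\<^sub>1 C\<^sub>0 C\<^sub>1 C\<^sub>K C\<^sub>K' :: real.
    c\<^sub>1 > 0 \<and> C\<^sub>0 > 0 \<and> C\<^sub>1 > 0 \<and> C\<^sub>K > 0 \<and> C\<^sub>K' > 0 \<and> C\<^sub>K' < C\<^sub>K \<and>
    (\<forall>(M :: 'w measure) (p :: nat) (n :: nat) (s :: nat) (X :: nat \<Rightarrow> 'w \<Rightarrow> nat \<Rightarrow> real).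
      let p\<^sub>1 = real (dim_z p);
          m\<^sub>1 = 16 * real s * (1 + k\<^sub>0)\<^sup>2;
          \<delta>\<^sub>0 = C\<^sub>K - C\<^sub>K';
          lmin = lambda_min_z M p (X 0);
          lmax = lambda_max_z M p (X 0)
      in
        prob_space M \<longrightarrow> p \<ge> 1 \<longrightarrow> s \<ge> 1 \<longrightarrow> iid_model M p n X \<longrightarrow>
        sub_Gaussian K\<^sub>x M p (X 0) \<longrightarrow> assumption_A2 a\<^sub>1 a\<^sub>2 M p (X 0) \<longrightarrow>
        assumption_A4 \<rho>bar M p (X 0) \<longrightarrow> assumption_A5 K\<^sub>u M p (X 0) \<longrightarrow>
        \<epsilon> < sqrt lmin / (8 * sqrt lmax + sqrt lmin) \<longrightarrow>
        real n > 1 / \<epsilon> * Max {C\<^sub>1,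
          (c\<^sub>1 * m\<^sub>1 / C\<^sub>K' * ln (c\<^sub>1 * m\<^sub>1 * p\<^sub>1)) ^ 3,
          (1 / 4 * (1 / C\<^sub>K') * c\<^sub>1 * m\<^sub>1 * ln (4 * c\<^sub>1 * m\<^sub>1 * p\<^sub>1)) ^ 3} \<longrightarrow>
        measure M {\<omega> \<in> space M. re_const (design_matrix M p n X \<omega>) k\<^sub>0 s > 0}
          \<ge> 1 - 2 * C\<^sub>0 * exp (- (real n powr (1 / 3) * \<epsilon> powr (1 / 3) * \<delta>\<^sub>0))) \<and>
    (\<lambda>n. 1 - 2 * C\<^sub>0 * exp (- (real n powr (1 / 3) * \<epsilon> powr (1 / 3) * (C\<^sub>K - C\<^sub>K')))) \<longlonglongrightarrow> 1"
proof -
  \<comment> \<open>The maximum with 1 keeps the sub-Gaussian bound and makes it positive.\<close>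
  define K where "K = max 1 K\<^sub>x"
  define b where "b = 1 / (16 * exp 1 * K\<^sup>2)"
  define D where "D = tail_const b"
  \<comment> \<open>The constants are fixed before (A2) is assumed. The default 1 only keeps
    \<open>a\<close> positive when \<open>a\<^sub>1 \<le> 0\<close>, a case that (A2)
    excludes.\<close>
  define a where "a = (if 0 < a\<^sub>1 then a\<^sub>1 else 1)"
  define \<epsilon>\<^sub>3 where "\<epsilon>\<^sub>3 = \<epsilon> powr (1 / 3)"
  define c\<^sub>1 where "c\<^sub>1 = 1 + \<epsilon>\<^sub>3 * (12 * D / b\<^sup>2 + 24 * D / b ^ 3 + 2 * b) / (8 * a * b) + 4 * \<epsilon>\<^sub>3 / b"
  define C\<^sub>0 where "C\<^sub>0 = (D + 1) * 48 / b ^ 3"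
  \<comment> \<open>Dividing by the cube root of \<epsilon> cancels that factor in the final
    exponent, which becomes \<open>b * N\<close>.\<close>
  define \<delta>\<^sub>0 where "\<delta>\<^sub>0 = b / \<epsilon>\<^sub>3"
  have K: "0 < K" "K\<^sub>x \<le> K" by (auto simp: K_def)
  have b: "0 < b" using K by (simp add: b_def)
  have D: "0 < D" by (simp add: D_def tail_const_pos)
  have a: "0 < a" by (simp add: a_def)
  have \<epsilon>\<^sub>3: "0 < \<epsilon>\<^sub>3" using assms by (simp add: \<epsilon>\<^sub>3_def)
  have c\<^sub>1: "0 < c\<^sub>1" unfolding c\<^sub>1_def using b D a \<epsilon>\<^sub>3 by (intro add_pos_pos divide_pos_pos mult_pos_pos) auto
  have \<delta>\<^sub>0: "0 < \<delta>\<^sub>0" using b \<epsilon>\<^sub>3 by (simp add: \<delta>\<^sub>0_def)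
  have C\<^sub>0: "0 < C\<^sub>0" using b D by (simp add: C\<^sub>0_def)
  have RE: "measure M {\<omega> \<in> space M. re_const (design_matrix M p n X \<omega>) k\<^sub>0 s > 0}
      \<ge> 1 - 2 * C\<^sub>0 * exp (- (real n powr (1 / 3) * \<epsilon> powr (1 / 3) * \<delta>\<^sub>0))"
    if M: "prob_space M" and p: "p \<ge> 1" and s: "s \<ge> 1" and iid: "iid_model M p n X"
      and sg: "sub_Gaussian K\<^sub>x M p (X 0)" and A2: "assumption_A2 a\<^sub>1 a\<^sub>2 M p (X 0)"
      and n: "real n > 1 / \<epsilon> * max 1 ((c\<^sub>1 * (16 * real s * (1 + k\<^sub>0)\<^sup>2)
        * ln (c\<^sub>1 * (16 * real s * (1 + k\<^sub>0)\<^sup>2) * real (dim_z p))) ^ 3)"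
    for M :: "'w measure" and p n s :: nat and X :: "nat \<Rightarrow> 'w \<Rightarrow> nat \<Rightarrow> real"
  proof -
    interpret prob_space M by fact
    define m\<^sub>1 where "m\<^sub>1 = 16 * real s * (1 + k\<^sub>0)\<^sup>2"
    define N where "N = real n powr (1 / 3)"
    have "0 < 1 / \<epsilon> * max 1 ((c\<^sub>1 * m\<^sub>1 * ln (c\<^sub>1 * m\<^sub>1 * real (dim_z p))) ^ 3)"
      using assms by (intro mult_pos_pos) auto
    with n have n_pos: "0 < n" by (simp add: m\<^sub>1_def)
    have N3: "N ^ 3 = real n"
      using n_pos by (simp add: N_def powr_power)
    have N1: "1 \<le> N" using n_pos by (simp add: N_def ge_one_powr_ge_zero)
    have \<epsilon>\<^sub>3_3: "\<epsilon>\<^sub>3 ^ 3 = \<epsilon>" using assms by (simp add: \<epsilon>\<^sub>3_def powr_power)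
    have "1 * 1 \<le> real s * (1 + k\<^sub>0)\<^sup>2"
      using s assms by (intro mult_mono) (auto simp: power_increasing one_le_power)
    then have m\<^sub>1: "16 \<le> m\<^sub>1" by (simp add: m\<^sub>1_def)
    have "(c\<^sub>1 * m\<^sub>1 * ln (c\<^sub>1 * m\<^sub>1 * real (dim_z p))) ^ 3 < \<epsilon> * real n"
      using n assms by (simp add: m\<^sub>1_def field_simps max_less_iff_conj)
    also have "\<dots> = (\<epsilon>\<^sub>3 * N) ^ 3"
      by (simp add: power_mult_distrib N3 \<epsilon>\<^sub>3_3)
    finally have large: "c\<^sub>1 * m\<^sub>1 * ln (c\<^sub>1 * m\<^sub>1 * real (dim_z p)) < \<epsilon>\<^sub>3 * N"
      using \<epsilon>\<^sub>3 N1 by (elim power_less_imp_less_base) auto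
    have d: "1 \<le> real (dim_z p)" using p by (simp add: dim_z_eq)
    have sgK: "psi2_norm_vec M p (X 0) \<le> ereal K"
      using sg K(2) unfolding sub_Gaussian_def by (meson ereal_less_eq(3) order.trans)
    have aA: "a \<le> lambda_min_z M p (X 0)"
      using A2 by (auto simp: assumption_A2_def a_def)
    have "1 - 2 * (real (dim_z p))\<^sup>2 * (real n * D * exp (- (2 * b * N))
        + exp (12 * D / b\<^sup>2 * N + 24 * D / b ^ 3 - b * N\<^sup>2 * (8 * a / m\<^sub>1)))
      \<le> prob {\<omega> \<in> space M. re_const (design_matrix M p n X \<omega>) k\<^sub>0 s > 0}"
      unfolding D_def
    proof (rule RE_probability_ge[OF iid sgK K(1) b_def a aA])
      \<comment> \<open>The choice \<open>8 * a / m\<^sub>1\<close> for \<tau> turns this inequality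
        into an equality.\<close>
      show "2 * (8 * a / m\<^sub>1) * real s * (1 + k\<^sub>0)\<^sup>2 \<le> a"
        using s assms by (simp add: m\<^sub>1_def)
    qed (use assms a m\<^sub>1 N1 N3 in auto)
    moreover have "2 * (real (dim_z p))\<^sup>2 * (real n * D * exp (- (2 * b * N))
        + exp (12 * D / b\<^sup>2 * N + 24 * D / b ^ 3 - b * N\<^sup>2 * (8 * a / m\<^sub>1)))
      \<le> 2 * C\<^sub>0 * exp (- (b * N))"
      unfolding C\<^sub>0_def by (rule tail_sum_le[OF b D a \<epsilon>\<^sub>3 N1 N3 d m\<^sub>1 c\<^sub>1_def large])
    moreover have "b * N = real n powr (1 / 3) * \<epsilon> powr (1 / 3) * \<delta>\<^sub>0"
      using \<epsilon>\<^sub>3 by (simp add: N_def \<delta>\<^sub>0_def \<epsilon>\<^sub>3_def[symmetric])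
    ultimately show ?thesis by simp
  qed
  \<comment> \<open>The witnesses \<open>C\<^sub>1 = 1\<close>, \<open>C\<^sub>K' = 1\<close> and
    \<open>C\<^sub>K = 1 + \<delta>\<^sub>0\<close> make the required difference equal to
    \<open>\<delta>\<^sub>0\<close>, and bring the sample-size condition into the form used in
    \<open>RE\<close>.\<close>
  show ?thesis
  proof (rule exI[of _ c\<^sub>1], rule exI[of _ C\<^sub>0], rule exI[of _ 1], rule exI[of _ "1 + \<delta>\<^sub>0"],
      rule exI[of _ 1], unfold Let_def, intro conjI allI impI)
    fix M :: "'w measure" and p n s :: nat and X :: "nat \<Rightarrow> 'w \<Rightarrow> nat \<Rightarrow> real"
    let ?m = "16 * real s * (1 + k\<^sub>0)\<^sup>2"
    let ?p = "real (dim_z p)"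
    let ?S = "{1, (c\<^sub>1 * ?m / 1 * ln (c\<^sub>1 * ?m * ?p)) ^ 3,
      (1 / 4 * (1 / 1) * c\<^sub>1 * ?m * ln (4 * c\<^sub>1 * ?m * ?p)) ^ 3}"
    assume M: "prob_space M" "1 \<le> p" "1 \<le> s" "iid_model M p n X" "sub_Gaussian K\<^sub>x M p (X 0)"
      "assumption_A2 a\<^sub>1 a\<^sub>2 M p (X 0)" and n: "1 / \<epsilon> * Max ?S < real n"
    have "max 1 ((c\<^sub>1 * ?m * ln (c\<^sub>1 * ?m * ?p)) ^ 3) \<le> Max ?S"
      by (intro max.boundedI Max_ge) auto
    then have "1 / \<epsilon> * max 1 ((c\<^sub>1 * ?m * ln (c\<^sub>1 * ?m * ?p)) ^ 3) \<le> 1 / \<epsilon> * Max ?S"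
      using assms by (intro mult_left_mono) auto
    with n have "1 / \<epsilon> * max 1 ((c\<^sub>1 * ?m * ln (c\<^sub>1 * ?m * ?p)) ^ 3) < real n"
      by linarith
    from RE[OF M this]
    show "1 - 2 * C\<^sub>0 * exp (- (real n powr (1 / 3) * \<epsilon> powr (1 / 3) * (1 + \<delta>\<^sub>0 - 1)))
        \<le> measure M {\<omega> \<in> space M. 0 < re_const (design_matrix M p n X \<omega>) k\<^sub>0 s}"
      by simp
  next
    show "(\<lambda>n. 1 - 2 * C\<^sub>0 * exp (- (real n powr (1 / 3) * \<epsilon> powr (1 / 3) * (1 + \<delta>\<^sub>0 - 1)))) \<longlonglongrightarrow> 1"
      using assms(2) \<delta>\<^sub>0 by (intro tendsto_one_minus_exp_powr) auto
  qed (use c\<^sub>1 C\<^sub>0 \<delta>\<^sub>0 in auto)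
qed

end
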